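(* Let $\Omega\subset\mathbb{R}^N$ be a bounded open set, $\sigma>0$, and $h:[0,\sigma)\to\mathbb{R}^+$ continuous, strictly increasing, with $\lim_{s\to\sigma^-}h(s)=+\infty$. Let $f\in L^p(\Omega)$, $p>N/2$. Suppose that there exists $\gamma\in[1,2)$ such that $\lim_{s\to\sigma^-}(\sigma-s)^\gamma h(s)=C>0$, and that there exists $\rho>0$ with $f(x)\ge\rho$ in $\Omega$. Then for $\lambda$ large enough the problem $$-\Delta u+h(u)|\nabla u|^2=\lambda f\text{ in }\Omega,\qquad u=0\text{ on }\partial\Omega$$ has no solution; hence $\Lambda_f<+\infty$.
   Context: A solution is $u\in H^1_0(\Omega)$ with $0\le u<\sigma$ a.e., $h(u)|\nabla u|^2\in L^1(\Omega)$ and $\int_\Omega\nabla u\cdot\nabla\varphi+\int_\Omega h(u)|\nabla u|^2\varphi=\lambda\int_\Omega f\varphi$ for all $\varphi\in H^1_0(\Omega)\cap L^\infty(\Omega)$. $\Lambda_f=\sup\{\lambda>0:\ \text{there is a solution } u \text{ with } u\le\sigma-\varepsilon \text{ a.e. for some }\varepsilon>0\}$, with $\sup\emptyset=0$. *)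

theory Defs
  imports "HOL-Analysis.Analysis"
begin

definition pdiff :: "('a::euclidean_space \<Rightarrow> real) \<Rightarrow> 'a \<Rightarrow> 'a \<Rightarrow> real" where
  "pdiff f i x = frechet_derivative f (at x) i"

definition grad :: "('a::euclidean_space \<Rightarrow> real) \<Rightarrow> 'a \<Rightarrow> 'a" where
  "grad f x = (\<Sum>i\<in>Basis. pdiff f i x *\<^sub>R i)"

fun Ck :: "nat \<Rightarrow> ('a::euclidean_space \<Rightarrow> real) \<Rightarrow> bool" where
  "Ck 0 f = continuous_on UNIV f"
| "Ck (Suc k) f = (f differentiable_on UNIV \<and> continuous_on UNIV f \<and>
                   (\<forall>i\<in>Basis. Ck k (pdiff f i)))"

definition smooth :: "('a::euclidean_space \<Rightarrow> real) \<Rightarrow> bool" where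
  "smooth f \<longleftrightarrow> (\<forall>k. Ck k f)"

text \<open>Test functions C_c^infinity(Omega) (extended by zero to the whole space).\<close>
definition test_fn :: "'a::euclidean_space set \<Rightarrow> ('a \<Rightarrow> real) \<Rightarrow> bool" where
  "test_fn \<Omega> \<phi> \<longleftrightarrow> smooth \<phi> \<and> compact (closure {x. \<phi> x \<noteq> 0}) \<and> closure {x. \<phi> x \<noteq> 0} \<subseteq> \<Omega>"

definition L2 :: "'a::euclidean_space set \<Rightarrow> ('a \<Rightarrow> 'b::euclidean_space) \<Rightarrow> bool" where
  "L2 \<Omega> v \<longleftrightarrow> set_borel_measurable lebesgue \<Omega> v \<and> set_integrable lebesgue \<Omega> (\<lambda>x. (norm (v x))\<^sup>2)"

definition Lp :: "real \<Rightarrow> 'a::euclidean_space set \<Rightarrow> ('a \<Rightarrow> real) \<Rightarrow> bool" where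
  "Lp p \<Omega> v \<longleftrightarrow> set_borel_measurable lebesgue \<Omega> v \<and> set_integrable lebesgue \<Omega> (\<lambda>x. \<bar>v x\<bar> powr p)"

definition ess_bounded :: "'a::euclidean_space set \<Rightarrow> ('a \<Rightarrow> real) \<Rightarrow> bool" where
  "ess_bounded \<Omega> v \<longleftrightarrow> set_borel_measurable lebesgue \<Omega> v \<and>
     (\<exists>M. AE x in lebesgue. x \<in> \<Omega> \<longrightarrow> \<bar>v x\<bar> \<le> M)"

definition weak_grad :: "'a::euclidean_space set \<Rightarrow> ('a \<Rightarrow> real) \<Rightarrow> ('a \<Rightarrow> 'a) \<Rightarrow> bool" where
  "weak_grad \<Omega> u g \<longleftrightarrow> (\<forall>\<phi>. test_fn \<Omega> \<phi> \<longrightarrow> (\<forall>i\<in>Basis.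
      (LINT x:\<Omega>|lebesgue. u x * pdiff \<phi> i x) = - (LINT x:\<Omega>|lebesgue. (g x \<bullet> i) * \<phi> x)))"

definition H10 :: "'a::euclidean_space set \<Rightarrow> ('a \<Rightarrow> real) \<Rightarrow> ('a \<Rightarrow> 'a) \<Rightarrow> bool" where
  "H10 \<Omega> u g \<longleftrightarrow> L2 \<Omega> u \<and> L2 \<Omega> g \<and> weak_grad \<Omega> u g \<and>
     (\<exists>\<phi>s. (\<forall>n. test_fn \<Omega> (\<phi>s n)) \<and>
        (\<lambda>n. LINT x:\<Omega>|lebesgue. (\<phi>s n x - u x)\<^sup>2) \<longlonglongrightarrow> 0 \<and>
        (\<lambda>n. LINT x:\<Omega>|lebesgue. (norm (grad (\<phi>s n) x - g x))\<^sup>2) \<longlonglongrightarrow> 0)"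

definition is_solution :: "'a::euclidean_space set \<Rightarrow> real \<Rightarrow> (real \<Rightarrow> real) \<Rightarrow> ('a \<Rightarrow> real)
     \<Rightarrow> real \<Rightarrow> ('a \<Rightarrow> real) \<Rightarrow> bool" where
  "is_solution \<Omega> \<sigma> h f lam u \<longleftrightarrow> (\<exists>g. H10 \<Omega> u g \<and>
     (AE x in lebesgue. x \<in> \<Omega> \<longrightarrow> 0 \<le> u x \<and> u x < \<sigma>) \<and>
     set_integrable lebesgue \<Omega> (\<lambda>x. h (u x) * (norm (g x))\<^sup>2) \<and>
     (\<forall>\<phi> \<psi>. H10 \<Omega> \<phi> \<psi> \<and> ess_bounded \<Omega> \<phi> \<longrightarrow>
        (LINT x:\<Omega>|lebesgue. g x \<bullet> \<psi> x) + (LINT x:\<Omega>|lebesgue. h (u x) * (norm (g x))\<^sup>2 * \<phi> x)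
          = lam * (LINT x:\<Omega>|lebesgue. f x * \<phi> x)))"

definition Lambda_set :: "'a::euclidean_space set \<Rightarrow> real \<Rightarrow> (real \<Rightarrow> real) \<Rightarrow> ('a \<Rightarrow> real) \<Rightarrow> real set" where
  "Lambda_set \<Omega> \<sigma> h f = {lam. lam > 0 \<and> (\<exists>u \<epsilon>. \<epsilon> > 0 \<and> is_solution \<Omega> \<sigma> h f lam u \<and>
       (AE x in lebesgue. x \<in> \<Omega> \<longrightarrow> u x \<le> \<sigma> - \<epsilon>))}"

definition Lambda_f :: "'a::euclidean_space set \<Rightarrow> real \<Rightarrow> (real \<Rightarrow> real) \<Rightarrow> ('a \<Rightarrow> real) \<Rightarrow> ereal" where
  "Lambda_f \<Omega> \<sigma> h f = (if Lambda_set \<Omega> \<sigma> h f = {} then 0 else Sup (ereal ` Lambda_set \<Omega> \<sigma> h f))"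

end

theory Submission
  imports Defs
begin

text \<open>
  Put \<open>G = exp (- H)\<close> with \<open>H' = h\<close> and \<open>v' = G\<close>. Then \<open>v(u)\<close> solves the semilinear equation
  \<open>- \<Delta>(v(u)) = \<lambda> f G(u)\<close>, whose right-hand side decreases in \<open>u\<close>, so a comparison principle holds: testing
  with \<open>G(u) \<beta>(v(U) - v(u))\<close>, \<open>\<beta>(t) = (max 0 t)\<^sup>2\<close>, gives \<open>u \<ge> U\<close> whenever \<open>U < \<sigma>\<close> is negative near the boundary and
  \<open>- \<Delta>U + h(U) |\<nabla>U|\<^sup>2 < \<lambda> \<rho>\<close> on \<open>{U > 0}\<close>.
  Since \<open>h(s) = O((\<sigma> - s)\<^bsup>-\<gamma>\<^esup>)\<close> with \<open>\<gamma> < 2\<close>, the function \<open>U(x) = s - A |x - z|\<^bsup>2m\<^esup>\<close> satisfies this as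
  soon as \<open>m (2 - \<gamma>) \<ge> 1\<close> and \<open>\<lambda>\<close> exceeds a bound independent of \<open>s < \<sigma>\<close> and of the centre \<open>z\<close> in a
  small ball. Letting \<open>s\<close> tend to \<open>\<sigma>\<close> and \<open>z\<close> run through a countable dense set yields \<open>u \<ge> \<sigma>\<close>
  almost everywhere in that ball, which contradicts \<open>u < \<sigma>\<close>.
\<close>

section \<open>Functions of class Ck\<close>

text \<open>Since \<open>h(u)\<close> may be unbounded along a solution, v(u) itself is never shown
  to lie in \<open>H10\<close>; the test function carries the change of variable. The gradient of
  \<open>G(u) \<beta>(v(U) - v(u))\<close> contains -h(u) G(u) \<beta> grad u, which cancels the
  quadratic term of the equation. Squaring the positive part makes the test function a C^1
  expression in U and u, so that its membership in \<open>H10\<close> follows by approximation with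
  C^1 functions. The strict inequality required of U closes the argument: a nonnegative integrand
  with zero integral vanishes a.e., and it is positive wherever \<beta> is.

  The exponent of the barrier comes from scaling. With q = |x - z|^2 and D = A q^m one has \<sigma>
  - U \<ge> D and |grad U|^2 = 4 m^2 D^2 / q, so h(U) |grad U|^2 is at most a constant times D^(2 -
  \<gamma>) / q, that is, times q^(m (2 - \<gamma>) - 1). For a paraboloid, m = 1, and \<gamma> > 1
  this estimate is singular at z; it is bounded as soon as m (2 - \<gamma>) \<ge> 1, and such an m
  exists exactly because \<gamma> < 2.\<close>

lemma pdiff_eq:
  assumes "(f has_derivative f') (at x)"
  shows "pdiff f i x = f' i"
  using frechet_derivative_at[OF assms] by (simp add: pdiff_def)

lemma grad_inner_Basis: "i \<in> Basis \<Longrightarrow> grad f x \<bullet> i = pdiff f i x"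
  unfolding grad_def by (simp add: inner_sum_left inner_Basis if_distrib cong: if_cong)

lemma grad_inner_if_has_derivative:
  assumes "(f has_derivative f') (at x)"
  shows "grad f x \<bullet> d = f' d"
proof -
  have lin: "linear f'" using assms by (simp add: has_derivative_linear)
  have "f' d = f' (\<Sum>i\<in>Basis. (d \<bullet> i) *\<^sub>R i)" by (simp add: euclidean_representation)
  also have "\<dots> = (\<Sum>i\<in>Basis. (d \<bullet> i) * f' i)"
    by (simp add: linear_sum[OF lin] linear_cmul[OF lin])
  also have "\<dots> = grad f x \<bullet> d"
    unfolding grad_def inner_sum_left using pdiff_eq[OF assms]
    by (intro sum.cong) (auto simp: inner_commute mult.commute)
  finally show ?thesis by simp
qed

lemma grad_eqI:
  assumes "(f has_derivative (\<lambda>d. g \<bullet> d)) (at x)"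
  shows "grad f x = g"
  using grad_inner_if_has_derivative[OF assms] by (intro vector_eq_ldot[THEN iffD1]) (simp add: inner_commute)

lemma Ck_SucD: "Ck (Suc k) f \<Longrightarrow> Ck k f"
  by (induction k arbitrary: f) auto

lemma Ck_SucI:
  assumes "\<And>x. (f has_derivative f' x) (at x)" "\<And>i. i \<in> Basis \<Longrightarrow> Ck k (\<lambda>x. f' x i)"
  shows "Ck (Suc k) f"
proof -
  have "pdiff f i = (\<lambda>x. f' x i)" for i using pdiff_eq[OF assms(1)] by blast
  moreover have "f differentiable_on UNIV"
    using assms(1) by (auto simp: differentiable_on_def differentiable_def intro: has_derivative_at_withinI)
  ultimately show ?thesis using assms(2) by (auto intro: differentiable_imp_continuous_on)
qed

lemma Ck_has_derivative:
  assumes "Ck (Suc k) f"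
  shows "(f has_derivative (\<lambda>d. grad f x \<bullet> d)) (at x)"
proof -
  have "f differentiable at x" using assms by (auto simp: differentiable_on_def)
  then obtain f' where f': "(f has_derivative f') (at x)" by (auto simp: differentiable_def)
  then show ?thesis using grad_inner_if_has_derivative[OF f'] by presburger
qed

lemma Ck_continuous: "Ck k f \<Longrightarrow> continuous_on S f"
  by (cases k) (auto intro: continuous_on_subset)

lemma Ck_Suc_continuous_pdiff: "Ck (Suc k) f \<Longrightarrow> i \<in> Basis \<Longrightarrow> continuous_on S (pdiff f i)"
  by (auto intro: Ck_continuous)

lemma Ck_Suc_continuous_grad: "Ck (Suc k) f \<Longrightarrow> continuous_on S (grad f)"
  unfolding grad_def[abs_def] by (intro continuous_intros Ck_Suc_continuous_pdiff)

lemma Ck_add: "Ck k f \<Longrightarrow> Ck k g \<Longrightarrow> Ck k (\<lambda>x. f x + g x)"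
proof (induction k arbitrary: f g)
  case 0 then show ?case by (auto intro: continuous_intros)
next
  case (Suc k)
  show ?case
    by (rule Ck_SucI, rule has_derivative_add[OF Ck_has_derivative[OF Suc.prems(1)] Ck_has_derivative[OF Suc.prems(2)]])
       (use Suc in \<open>auto simp: grad_inner_Basis\<close>)
qed

lemma Ck_mult: "Ck k f \<Longrightarrow> Ck k g \<Longrightarrow> Ck k (\<lambda>x. f x * g x)"
proof (induction k arbitrary: f g)
  case 0 then show ?case by (auto intro: continuous_intros)
next
  case (Suc k)
  show ?case
    by (rule Ck_SucI, rule has_derivative_mult[OF Ck_has_derivative[OF Suc.prems(1)] Ck_has_derivative[OF Suc.prems(2)]])
       (use Suc Suc.prems[THEN Ck_SucD] in \<open>auto simp: grad_inner_Basis intro!: Ck_add\<close>)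
qed

lemma Ck_const: "Ck k (\<lambda>x. c)"
proof (induction k arbitrary: c)
  case (Suc k)
  show ?case by (rule Ck_SucI[where f' = "\<lambda>_ _. 0"]) (auto intro: Suc)
qed auto

lemma Ck_inner: "Ck k (\<lambda>x. x \<bullet> a)"
proof (cases k)
  case (Suc n)
  show ?thesis unfolding Suc
    by (rule Ck_SucI[where f' = "\<lambda>_ d. d \<bullet> a"]) (auto intro: Ck_const intro!: derivative_eq_intros)
qed (auto intro: continuous_intros)

lemmas Ck_intros = Ck_add Ck_mult Ck_const Ck_inner

section \<open>A family of flat functions and the mollifiers built from it\<close>

definition flat_exp :: "nat \<Rightarrow> real \<Rightarrow> real" where
  "flat_exp m t = (if t \<le> 0 then 0 else exp (- 1 / t) / t ^ m)"

text \<open>Keep only the term of degree m + 2 in the series of exp(1/t): it beats 1/t^m with two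
  powers of t to spare. One of them survives in the difference quotient at 0, so the derivative
  there is 0.\<close>

lemma flat_exp_bound: "\<bar>flat_exp m t\<bar> \<le> fact (m + 2) * t\<^sup>2"
proof (cases "t \<le> 0")
  case False
  then have t: "t > 0" by simp
  have "(1 / t) ^ (m + 2) / fact (m + 2) \<le> exp (1 / t)"
  proof -
    have "(\<Sum>n\<in>{m+2}. inverse (fact n) *\<^sub>R (1/t) ^ n) \<le> (\<Sum>n. inverse (fact n) *\<^sub>R (1/t) ^ n)"
      by (rule sum_le_suminf) (use t summable_exp_generic[of "1/t"] in auto)
    then show ?thesis by (simp add: exp_def divide_inverse mult.commute)
  qed
  then have "1 \<le> exp (1 / t) * (fact (m + 2) * t ^ (m + 2))"
    using t by (simp add: power_one_over divide_simps mult.commute mult.left_commute del: fact_Suc)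
  then have "exp (- 1 / t) * 1 \<le> exp (- 1 / t) * (exp (1 / t) * (fact (m + 2) * t ^ (m + 2)))"
    by (intro mult_left_mono) auto
  also have "\<dots> = (fact (m + 2) * t\<^sup>2) * t ^ m"
    unfolding mult.assoc[symmetric] exp_add[symmetric] by (simp add: power_add power2_eq_square mult.assoc mult.left_commute del: fact_Suc)
  finally have "exp (- 1 / t) / t ^ m \<le> fact (m + 2) * t\<^sup>2"
    using t by (simp add: pos_divide_le_eq del: fact_Suc)
  then show ?thesis using False t by (simp add: flat_exp_def del: fact_Suc)
qed (auto simp: flat_exp_def simp del: fact_Suc)

text \<open>The parameter \<open>m\<close> is there because the derivative is again a linear
  combination of members of the family. Smoothness then follows by induction on the order with
  \<open>m\<close> arbitrary.\<close>

lemma flat_exp_has_derivative: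
  "(flat_exp m has_real_derivative (flat_exp (m + 2) t - real m * flat_exp (m + 1) t)) (at t)"
proof -
  consider "t < 0" | "t > 0" | "t = 0" by linarith
  then show ?thesis
  proof cases
    case 1
    have "((\<lambda>_. 0) has_real_derivative 0) (at t)" by simp
    then have "(flat_exp m has_real_derivative 0) (at t)"
      by (rule DERIV_cong_ev[THEN iffD1, rotated 3])
         (use 1 eventually_nhds_in_open[of "{..<0}" t] in \<open>auto elim!: eventually_mono simp: flat_exp_def\<close>)
    then show ?thesis using 1 by (simp add: flat_exp_def)
  next
    case 2
    have D: "((\<lambda>t. exp (- 1 / t) / t ^ m) has_real_derivative
        (exp (- 1 / t) * (1 / t\<^sup>2) * t ^ m - exp (- 1 / t) * (real m * t ^ (m - 1))) / (t ^ m * t ^ m)) (at t)"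
      using 2 by (auto intro!: derivative_eq_intros simp: power2_eq_square)
    have e: "(exp (- 1 / t) * (1 / t\<^sup>2) * t ^ m - exp (- 1 / t) * (real m * t ^ (m - 1))) / (t ^ m * t ^ m)
       = flat_exp (m + 2) t - real m * flat_exp (m + 1) t"
    proof -
      have "real m * t ^ (m - 1) = real m * t ^ m / t" using 2 by (cases m) auto
      then show ?thesis using 2 by (simp add: flat_exp_def divide_simps power2_eq_square) (auto simp: algebra_simps)
    qed
    show ?thesis
      by (rule DERIV_cong_ev[THEN iffD1, OF refl _ e D])
         (use 2 eventually_nhds_in_open[of "{0<..}" t] in \<open>auto elim!: eventually_mono simp: flat_exp_def\<close>)
  next
    case 3
    have "((\<lambda>s. flat_exp m s / s) \<longlongrightarrow> 0) (at 0)"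
    proof (rule Lim_null_comparison[where g = "\<lambda>s. fact (m + 2) * \<bar>s\<bar>"])
      show "\<forall>\<^sub>F x in at 0. norm (flat_exp m x / x) \<le> fact (m + 2) * \<bar>x\<bar>"
        unfolding eventually_at_filter
      proof (intro always_eventually allI impI)
        fix x :: real assume "x \<noteq> 0"
        then have "\<bar>flat_exp m x\<bar> / \<bar>x\<bar> \<le> fact (m + 2) * \<bar>x\<bar>"
          using flat_exp_bound[of m x]
          by (simp add: divide_le_eq power2_eq_square abs_mult_self_eq mult.assoc del: fact_Suc)
        then show "norm (flat_exp m x / x) \<le> fact (m + 2) * \<bar>x\<bar>" by (simp add: abs_divide del: fact_Suc)
      qed
    qed (auto intro!: tendsto_eq_intros simp del: fact_Suc)
    then have "(flat_exp m has_real_derivative 0) (at 0)"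
      by (simp add: DERIV_def flat_exp_def)
    then show ?thesis using 3 by (simp add: flat_exp_def)
  qed
qed

lemma Ck_flat_exp: "Ck k (\<lambda>x::'a::euclidean_space. flat_exp m (c - x \<bullet> x))"
proof (induction k arbitrary: m)
  case 0
  have "continuous_on UNIV (flat_exp m)"
    by (intro continuous_at_imp_continuous_on ballI DERIV_isCont[OF flat_exp_has_derivative])
  then show ?case by (auto intro!: continuous_intros continuous_on_compose2[of UNIV "flat_exp m"])
next
  case (Suc k)
  show ?case
  proof (rule Ck_SucI)
    fix x :: 'a
    have "((\<lambda>x. c - x \<bullet> x) has_derivative (\<lambda>d. - 2 * (d \<bullet> x))) (at x)"
      by (auto intro!: derivative_eq_intros simp: inner_commute)
    from has_derivative_compose[OF this flat_exp_has_derivative[unfolded has_field_derivative_def]]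
    show "((\<lambda>x. flat_exp m (c - x \<bullet> x)) has_derivative
       (\<lambda>d. (flat_exp (m + 2) (c - x \<bullet> x) + (- real m) * flat_exp (m + 1) (c - x \<bullet> x)) * (- 2 * (x \<bullet> d)))) (at x)"
      by (simp add: inner_commute)
  qed (intro Ck_intros Suc)
qed

lemma continuous_compact_support_integrable:
  fixes f :: "'a::euclidean_space \<Rightarrow> 'b::{banach, second_countable_topology}"
  assumes "continuous_on UNIV f" "compact K" "\<And>x. x \<notin> K \<Longrightarrow> f x = 0"
  shows "integrable lborel f"
proof -
  have "(\<lambda>x. indicator K x *\<^sub>R f x) = f" using assms(3) by (auto simp: indicator_def fun_eq_iff)
  then show ?thesis
    using borel_integrable_compact[of K f] assms continuous_on_subset[of UNIV f K] by simp
qed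

lemma lborel_integral_translation:
  fixes f :: "'a::euclidean_space \<Rightarrow> real"
  assumes "f \<in> borel_measurable borel"
  shows "(\<integral>x. f (c + x) \<partial>lborel) = (\<integral>x. f x \<partial>lborel)"
proof -
  have "(\<integral>x. f x \<partial>lborel) = (\<integral>x. f x \<partial>distr lborel borel ((+) c))" by (simp add: lborel_distr_plus)
  also have "\<dots> = (\<integral>x. f (c + x) \<partial>lborel)" by (rule integral_distr) (use assms in auto)
  finally show ?thesis by simp
qed

text \<open>The bump is divided by its integral, which is nonzero because a nonempty open ball is
  not a null set. Evenness is recorded so that \<open>\<eta> (x - y)\<close>, as a function of y, is
  a translate of \<eta> and has integral 1.\<close>

lemma mollifier_exists:
  assumes "e > 0"
  obtains \<eta> :: "'a::euclidean_space \<Rightarrow> real" where "smooth \<eta>" "\<And>x. \<eta> x \<ge> 0" "\<And>x. \<eta> (- x) = \<eta> x"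
    "\<And>x. norm x \<ge> e \<Longrightarrow> \<eta> x = 0" "integral\<^sup>L lborel \<eta> = 1"
proof -
  define b where "b = (\<lambda>x::'a. flat_exp 0 (e\<^sup>2 - x \<bullet> x))"
  define I where "I = integral\<^sup>L lborel b"
  have b0: "b x \<ge> 0" for x by (simp add: b_def flat_exp_def)
  have bz: "b x = 0" if "norm x \<ge> e" for x
    using power_mono[OF that, of 2] assms by (simp add: b_def flat_exp_def dot_square_norm)
  have bpos: "b x > 0" if "norm x < e" for x
    using power_strict_mono[OF that, of 2] by (simp add: b_def flat_exp_def dot_square_norm)
  have cont: "continuous_on UNIV b" using Ck_flat_exp[of 0] by (simp add: b_def)
  have int: "integrable lborel b"
    by (rule continuous_compact_support_integrable[OF cont, of "cball 0 e"]) (auto intro: bz)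
  have "I \<noteq> 0"
  proof
    assume "I = 0"
    then have "AE x in lborel. b x = 0"
      using integral_nonneg_eq_0_iff_AE[OF int] b0 by (simp add: I_def)
    then have "AE x in lborel. x \<notin> ball (0::'a) e"
      by (rule eventually_mono) (auto dest!: bpos)
    then have "ball (0::'a) e \<in> null_sets (lborel :: 'a measure)"
      by (subst AE_iff_null_sets) auto
    then have "negligible (ball (0::'a) e)"
      unfolding negligible_iff_null_sets by (rule null_sets_completionI)
    then show False using open_not_negligible[of "ball (0::'a) e"] assms by auto
  qed
  moreover have "I \<ge> 0" unfolding I_def using b0 by (intro integral_nonneg_AE) auto
  ultimately have I: "I > 0" by simp
  show thesis
  proof (rule that[of "\<lambda>x. b x * (1 / I)"])
    show "smooth (\<lambda>x. b x * (1 / I))"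
      unfolding smooth_def b_def by (intro allI Ck_mult Ck_flat_exp Ck_const)
    show "(\<integral>x. b x * (1 / I) \<partial>lborel) = 1" using I by (subst integral_mult_left_zero) (simp add: I_def)
  qed (use b0 bz I in \<open>auto simp: b_def\<close>)
qed

section \<open>Integration by parts and mollification\<close>

lemma pdiff_zero_off_closed:
  fixes w :: "'a::euclidean_space \<Rightarrow> real"
  assumes "closed K" "\<And>x. x \<notin> K \<Longrightarrow> w x = 0" "x \<notin> K"
  shows "pdiff w i x = 0"
proof -
  have "(w has_derivative (\<lambda>_. 0)) (at x)"
  proof (rule has_derivative_transform_within_open[where f = "\<lambda>_. 0"])
    show "open (- K)" using assms(1) by auto
  qed (use assms in auto)
  then show ?thesis by (simp add: pdiff_eq)
qed

lemma grad_zero_off_closed: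
  fixes w :: "'a::euclidean_space \<Rightarrow> real"
  assumes "closed K" "\<And>x. x \<notin> K \<Longrightarrow> w x = 0" "x \<notin> K"
  shows "grad w x = 0"
  using pdiff_zero_off_closed[OF assms] by (simp add: grad_def)

lemma bounded_if_compact_support:
  fixes f :: "'a::euclidean_space \<Rightarrow> 'b::real_normed_vector"
  assumes "continuous_on UNIV f" "compact K" "\<And>x. x \<notin> K \<Longrightarrow> f x = 0"
  obtains B where "B \<ge> 0" "\<And>x. norm (f x) \<le> B"
proof -
  have "compact (f ` K)" using assms by (intro compact_continuous_image continuous_on_subset[OF assms(1)]) auto
  then obtain B where "\<forall>y\<in>f ` K. norm y \<le> B" by (meson bounded_iff compact_imp_bounded)
  then show thesis using assms(3) by (intro that[of "max 0 B"]) (force simp: le_max_iff_disj)+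
qed

lemma Ck_Lipschitz:
  fixes w :: "'a::euclidean_space \<Rightarrow> real"
  assumes "Ck (Suc k) w" "compact K" "\<And>x. x \<notin> K \<Longrightarrow> w x = 0"
  obtains B where "B \<ge> 0" "\<And>x y. \<bar>w x - w y\<bar> \<le> B * norm (x - y)"
proof -
  obtain B where B: "B \<ge> 0" "\<And>x. norm (grad w x) \<le> B"
    by (rule bounded_if_compact_support[OF Ck_Suc_continuous_grad[OF assms(1)] assms(2)
          grad_zero_off_closed[OF compact_imp_closed[OF assms(2)] assms(3)]]) auto
  have "norm (w x - w y) \<le> B * norm (x - y)" for x y
  proof (rule differentiable_bound[where S = UNIV])
    show "(w has_derivative (\<lambda>d. grad w x \<bullet> d)) (at x within UNIV)" for x
      using Ck_has_derivative[OF assms(1)] by simp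
    show "onorm ((\<bullet>) (grad w x)) \<le> B" for x
    proof (rule onorm_le)
      fix d
      show "norm (grad w x \<bullet> d) \<le> B * norm d"
        using Cauchy_Schwarz_ineq2[of "grad w x" d] mult_right_mono[OF B(2)[of x], of "norm d"] by simp
    qed
  qed auto
  then show thesis using B that by simp
qed

text \<open>Translation invariance of Lebesgue measure: every difference quotient has integral 0,
  and the quotients converge to the partial derivative under a common bound.\<close>

lemma integral_pdiff_eq_0:
  fixes w :: "'a::euclidean_space \<Rightarrow> real"
  assumes w: "Ck (Suc k) w" "compact K" "\<And>x. x \<notin> K \<Longrightarrow> w x = 0" and i: "i \<in> Basis"
  shows "(\<integral>x. pdiff w i x \<partial>lborel) = 0"
proof -
  define t where "t = (\<lambda>n. 1 / real (Suc n))"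
  have t: "0 < t n" "t n \<le> 1" for n by (auto simp: t_def)
  define q where "q = (\<lambda>n x. (w (t n *\<^sub>R i + x) - w x) / t n)"
  have cont: "continuous_on UNIV w" using Ck_continuous[OF w(1)] .
  have meas[measurable]: "w \<in> borel_measurable borel" using cont by (rule borel_measurable_continuous_onI)
  have int: "integrable lborel w" by (rule continuous_compact_support_integrable[OF cont w(2,3)])
  have pm: "pdiff w i \<in> borel_measurable borel"
    by (rule borel_measurable_continuous_onI[OF Ck_Suc_continuous_pdiff[OF w(1) i]])
  obtain B where B: "B \<ge> 0" "\<And>x y. \<bar>w x - w y\<bar> \<le> B * norm (x - y)" using Ck_Lipschitz[OF w] by blast
  obtain r where r: "\<And>x. x \<in> K \<Longrightarrow> norm x \<le> r"
    using compact_imp_bounded[OF w(2)] bounded_iff by metis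
  have "integrable lborel (\<lambda>x. w (t n *\<^sub>R i + x))" for n
    using integrable_distr_eq[of "(+) (t n *\<^sub>R i)" lborel borel w] int lborel_distr_plus[of "t n *\<^sub>R i"] by simp
  then have "(\<integral>x. q n x \<partial>lborel) = 0" for n
    unfolding q_def using int lborel_integral_translation[OF meas, of "t n *\<^sub>R i"] by simp
  \<comment> \<open>The Lipschitz constant \<open>B\<close> bounds the quotients. Since the steps
    \<open>t n\<close> are at most 1, the shifted supports stay in the ball of radius
    \<open>r + 1\<close>.\<close>
  moreover have "(\<lambda>n. \<integral>x. q n x \<partial>lborel) \<longlonglongrightarrow> (\<integral>x. pdiff w i x \<partial>lborel)"
  proof (rule integral_dominated_convergence[where w = "\<lambda>x. indicator (cball 0 (r + 1)) x *\<^sub>R B"])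
    show "integrable lborel (\<lambda>x::'a. indicator (cball 0 (r + 1)) x *\<^sub>R B)"
      by (rule borel_integrable_compact) auto
    show "AE x in lborel. (\<lambda>n. q n x) \<longlonglongrightarrow> pdiff w i x"
    proof (intro always_eventually allI)
      fix x
      have "((\<lambda>s. w (s *\<^sub>R i + x)) has_real_derivative (grad w x \<bullet> i)) (at 0)"
        unfolding has_field_derivative_def
        by (rule has_derivative_eq_rhs, rule has_derivative_compose[where g = w and f = "\<lambda>s. s *\<^sub>R i + x"],
            (rule derivative_intros)+, rule Ck_has_derivative) (use w in \<open>auto simp: mult.commute\<close>)
      then have "((\<lambda>s. (w (s *\<^sub>R i + x) - w x) / s) \<longlongrightarrow> pdiff w i x) (at 0)"
        by (simp add: DERIV_def grad_inner_Basis[OF i])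
      moreover have "filterlim t (at 0) sequentially"
        unfolding filterlim_at t_def using LIMSEQ_inverse_real_of_nat by (auto simp: inverse_eq_divide)
      ultimately show "(\<lambda>n. q n x) \<longlonglongrightarrow> pdiff w i x"
        unfolding q_def by (rule filterlim_compose)
    qed
    show "AE x in lborel. norm (q n x) \<le> indicator (cball 0 (r + 1)) x *\<^sub>R B" for n
    proof (intro always_eventually allI)
      fix x
      show "norm (q n x) \<le> indicator (cball 0 (r + 1)) x *\<^sub>R B"
      proof (cases "x \<in> cball 0 (r + 1)")
        case True
        have "\<bar>w (t n *\<^sub>R i + x) - w x\<bar> \<le> B * t n"
          using B(2)[of "t n *\<^sub>R i + x" x] t[of n] i by simp
        then show ?thesis using True t[of n] by (simp add: q_def field_simps abs_divide)
      next
        case False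
        have "norm x \<le> norm (t n *\<^sub>R i + x) + norm (t n *\<^sub>R i)"
          by (metis add_diff_cancel_left' norm_triangle_ineq4 add.commute)
        then have "norm (t n *\<^sub>R i + x) > r" using False t[of n] i by simp
        then have "w (t n *\<^sub>R i + x) = 0" "w x = 0" using w(3) r False by force+
        then show ?thesis by (simp add: q_def B)
      qed
    qed
    show "q n \<in> borel_measurable lborel" for n unfolding q_def by measurable
  qed (use pm in auto)
  ultimately show ?thesis by (simp add: LIMSEQ_const_iff)
qed

lemma pdiff_mult:
  assumes "Ck (Suc k) a" "Ck (Suc l) w" "i \<in> Basis"
  shows "pdiff (\<lambda>x. a x * w x) i x = a x * pdiff w i x + pdiff a i x * w x"
  using pdiff_eq[OF has_derivative_mult[OF Ck_has_derivative[OF assms(1)] Ck_has_derivative[OF assms(2)]]]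
  by (simp add: grad_inner_Basis[OF assms(3)])

text \<open>Only the product has to have compact support, so \<open>a\<close> may be any C^1
  function: a reflected kernel in \<open>pdiff_conv\<close>, a field component that does not vanish
  at the boundary in \<open>integration_by_parts_limit\<close>.\<close>

lemma integration_by_parts_compact_support:
  fixes w :: "'a::euclidean_space \<Rightarrow> real"
  assumes a: "Ck (Suc 0) a" and w: "Ck (Suc 0) w" "compact K" "\<And>x. x \<notin> K \<Longrightarrow> w x = 0" and i: "i \<in> Basis"
  shows "(\<integral>x. a x * pdiff w i x \<partial>lborel) = - (\<integral>x. pdiff a i x * w x \<partial>lborel)"
proof -
  have K: "closed K" using w(2) by (rule compact_imp_closed)
  note c = Ck_continuous[OF a] Ck_continuous[OF w(1)] Ck_Suc_continuous_pdiff[OF a i] Ck_Suc_continuous_pdiff[OF w(1) i]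
  have 1: "integrable lborel (\<lambda>x. a x * pdiff w i x)"
    by (rule continuous_compact_support_integrable[OF continuous_on_mult[OF c(1,4)] w(2)])
       (simp add: pdiff_zero_off_closed[OF K w(3)])
  have 2: "integrable lborel (\<lambda>x. pdiff a i x * w x)"
    by (rule continuous_compact_support_integrable[OF continuous_on_mult[OF c(3,2)] w(2)]) (simp add: w(3))
  have "(\<integral>x. pdiff (\<lambda>x. a x * w x) i x \<partial>lborel) = 0"
    by (rule integral_pdiff_eq_0[OF Ck_mult[OF a w(1)] w(2)]) (use w i in auto)
  then show ?thesis using Bochner_Integration.integral_add[OF 1 2] by (simp add: pdiff_mult[OF a w(1) i])
qed

section \<open>Convolution of a compactly supported function with a smooth kernel\<close>

definition conv :: "('a::euclidean_space \<Rightarrow> real) \<Rightarrow> ('a \<Rightarrow> real) \<Rightarrow> 'a \<Rightarrow> real" where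
  "conv w k x = (\<integral>y. w y * k (x - y) \<partial>lborel)"

text \<open>The box form is the one to which the Leibniz rule and continuity in a parameter are
  applied below.\<close>

lemma conv_eq_integral_cbox:
  fixes w :: "'a::euclidean_space \<Rightarrow> real"
  assumes "continuous_on UNIV w" "K \<subseteq> cbox a b" "\<And>x. x \<notin> K \<Longrightarrow> w x = 0" "continuous_on UNIV k"
  shows "conv w k x = integral (cbox a b) (\<lambda>y. w y * k (x - y))"
proof -
  have c: "continuous_on UNIV (\<lambda>y. w y * k (x - y))"
    using assms by (auto intro!: continuous_intros continuous_on_compose2[of UNIV k])
  have "set_integrable lborel (cbox a b) (\<lambda>y. w y * k (x - y))"
    unfolding set_integrable_def by (rule borel_integrable_compact) (auto intro: continuous_on_subset[OF c])
  note set_borel_integral_eq_integral(2)[OF this]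
  moreover have "indicator (cbox a b) y *\<^sub>R (w y * k (x - y)) = w y * k (x - y)" for y
    using assms by (auto simp: indicator_def)
  ultimately show ?thesis unfolding conv_def set_lebesgue_integral_def by (simp only:)
qed

lemma conv_has_derivative:
  fixes w :: "'a::euclidean_space \<Rightarrow> real"
  assumes w: "continuous_on UNIV w" "compact K" "\<And>x. x \<notin> K \<Longrightarrow> w x = 0" and k: "Ck (Suc n) k"
  obtains D where "(conv w k has_derivative D) (at x)" "\<And>i. i \<in> Basis \<Longrightarrow> D i = conv w (pdiff k i) x"
proof -
  obtain a b where ab: "K \<subseteq> cbox a b" using bounded_subset_cbox_symmetric[OF compact_imp_bounded[OF w(2)]] by blast
  define fx where "fx = (\<lambda>x y. blinfun_inner_right (w y *\<^sub>R grad k (x - y)))"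
  have cg: "continuous_on UNIV (grad k)" by (rule Ck_Suc_continuous_grad[OF k])
  have ck: "continuous_on UNIV k" by (rule Ck_continuous[OF k])
  have cfx: "continuous_on (UNIV \<times> cbox a b) (\<lambda>(x, y). fx x y)"
    unfolding fx_def split_beta
    by (intro continuous_intros continuous_on_compose2[OF cg] continuous_on_compose2[OF w(1)]) auto
  have D: "((\<lambda>x. integral (cbox a b) (\<lambda>y. w y * k (x - y))) has_derivative integral (cbox a b) (fx x)) (at x within UNIV)"
  proof (rule leibniz_rule[OF _ _ cfx])
    fix x y assume "y \<in> cbox a b"
    have "((\<lambda>x. x - y) has_derivative (\<lambda>d. d)) (at x)" by (auto intro!: derivative_eq_intros)
    from has_derivative_compose[OF this Ck_has_derivative[OF k]]
    have "((\<lambda>x. k (x - y)) has_derivative (\<lambda>d. grad k (x - y) \<bullet> d)) (at x)" .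
    then have "((\<lambda>x. w y * k (x - y)) has_derivative (\<lambda>d. w y * (grad k (x - y) \<bullet> d))) (at x)"
      by (rule has_derivative_mult_right)
    moreover have "blinfun_apply (fx x y) = (\<lambda>d. w y * (grad k (x - y) \<bullet> d))"
      by (simp add: fx_def fun_eq_iff)
    ultimately show "((\<lambda>x. w y * k (x - y)) has_derivative blinfun_apply (fx x y)) (at x within UNIV)"
      by simp
  next
    fix x
    show "(\<lambda>y. w y * k (x - y)) integrable_on cbox a b"
      by (intro integrable_continuous continuous_intros continuous_on_compose2[OF ck] continuous_on_compose2[OF w(1)]) auto
  qed auto
  have "blinfun_apply (integral (cbox a b) (fx x)) i = conv w (pdiff k i) x" if i: "i \<in> Basis" for i
  proof -
    have "fx x integrable_on cbox a b" 
      unfolding fx_def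
      by (intro integrable_continuous continuous_intros continuous_on_compose2[OF cg] continuous_on_compose2[OF w(1)]) auto
    then have "blinfun_apply (integral (cbox a b) (fx x)) i = integral (cbox a b) (\<lambda>y. blinfun_apply (fx x y) i)"
      by (rule blinfun_apply_integral)
    also have "\<dots> = conv w (pdiff k i) x"
      using conv_eq_integral_cbox[OF w(1) ab w(3) Ck_Suc_continuous_pdiff[OF k i]]
      by (simp add: fx_def grad_inner_Basis[OF i])
    finally show ?thesis .
  qed
  moreover have "conv w k = (\<lambda>x. integral (cbox a b) (\<lambda>y. w y * k (x - y)))"
    using conv_eq_integral_cbox[OF w(1) ab w(3) ck] by blast
  ultimately show thesis using D by (intro that[of "blinfun_apply (integral (cbox a b) (fx x))"]) auto
qed

lemma Ck_conv:
  fixes w :: "'a::euclidean_space \<Rightarrow> real"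
  assumes w: "continuous_on UNIV w" "compact K" "\<And>x. x \<notin> K \<Longrightarrow> w x = 0"
  shows "Ck n k \<Longrightarrow> Ck n (conv w k)"
proof (induction n arbitrary: k)
  case 0
  obtain a b where ab: "K \<subseteq> cbox a b" using bounded_subset_cbox_symmetric[OF compact_imp_bounded[OF w(2)]] by blast
  have k: "continuous_on UNIV k" using 0 by simp
  have "continuous_on UNIV (\<lambda>x. integral (cbox a b) (\<lambda>y. w y * k (x - y)))"
    by (rule integral_continuous_on_param)
       (auto simp: split_beta intro!: continuous_intros continuous_on_compose2[OF k] continuous_on_compose2[OF w(1)])
  then show ?case using conv_eq_integral_cbox[OF w(1) ab w(3) k] by (simp add: conv_def[abs_def])
next
  case (Suc n)
  have "\<forall>x. \<exists>D. (conv w k has_derivative D) (at x) \<and> (\<forall>i\<in>Basis. D i = conv w (pdiff k i) x)"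
    using conv_has_derivative[OF w Suc.prems] by metis
  then obtain D where D: "\<And>x. (conv w k has_derivative D x) (at x)"
      "\<And>x i. i \<in> Basis \<Longrightarrow> D x i = conv w (pdiff k i) x" by metis
  show ?case by (rule Ck_SucI[OF D(1)]) (use Suc D(2) in auto)
qed

text \<open>The derivative first falls on the kernel. Integrating by parts against y -> k (x - y)
  moves it to \<open>w\<close>; the sign from the reflection cancels the sign from the integration
  by parts.\<close>

lemma pdiff_conv:
  fixes w :: "'a::euclidean_space \<Rightarrow> real"
  assumes w: "Ck (Suc 0) w" "compact K" "\<And>x. x \<notin> K \<Longrightarrow> w x = 0" and k: "Ck (Suc 0) k" and i: "i \<in> Basis"
  shows "pdiff (conv w k) i x = conv (pdiff w i) k x"
proof -
  obtain D where D: "(conv w k has_derivative D) (at x)" "D i = conv w (pdiff k i) x"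
    using conv_has_derivative[OF Ck_continuous[OF w(1)] w(2,3) k] i by metis
  have *: "((\<lambda>y. k (x - y)) has_derivative (\<lambda>d. - (grad k (x - y) \<bullet> d))) (at y)" for y
  proof -
    have "((\<lambda>y. x - y) has_derivative (\<lambda>d. - d)) (at y)" by (auto intro!: derivative_eq_intros)
    from has_derivative_compose[OF this Ck_has_derivative[OF k]] show ?thesis by simp
  qed
  have pk: "pdiff (\<lambda>y. k (x - y)) i y = - pdiff k i (x - y)" for y
    using pdiff_eq[OF *] by (simp add: grad_inner_Basis[OF i])
  have "Ck (Suc 0) (\<lambda>y. k (x - y))"
    by (rule Ck_SucI[OF *])
       (auto simp: grad_inner_Basis intro!: continuous_intros continuous_on_compose2[OF Ck_Suc_continuous_pdiff[OF k, of _ UNIV]])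
  from integration_by_parts_compact_support[OF this w i]
  show ?thesis using pdiff_eq[OF D(1)] D(2) by (simp add: conv_def pk mult.commute)
qed

text \<open>The reflected kernel is a probability density concentrated where \<open>w\<close>
  differs from \<open>w x\<close> by at most \<open>e\<close>, so the weighted mean of
  \<open>w\<close> differs from \<open>w x\<close> by at most \<open>e\<close> too.\<close>

lemma conv_approx:
  fixes w :: "'a::euclidean_space \<Rightarrow> real"
  assumes w: "continuous_on UNIV w" "compact K" "\<And>x. x \<notin> K \<Longrightarrow> w x = 0"
    and k: "continuous_on UNIV k" "\<And>x. k x \<ge> 0" "\<And>x. k (- x) = k x" "\<And>x. norm x \<ge> d \<Longrightarrow> k x = 0"
       "integral\<^sup>L lborel k = 1"
    and osc: "\<And>x y. norm (x - y) < d \<Longrightarrow> \<bar>w x - w y\<bar> \<le> e"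
  shows "\<bar>conv w k x - w x\<bar> \<le> e"
proof -
  have ck: "continuous_on UNIV (\<lambda>y. k (x - y))" by (auto intro!: continuous_intros continuous_on_compose2[OF k(1)])
  have ik: "integrable lborel (\<lambda>y. k (x - y))"
    by (rule continuous_compact_support_integrable[OF ck, of "cball x d"]) (auto simp: dist_norm k(4))
  have iw: "integrable lborel (\<lambda>y. w y * k (x - y))"
    by (rule continuous_compact_support_integrable[OF continuous_on_mult[OF w(1) ck] w(2)]) (use w(3) in auto)
  have "(\<integral>y. k (x - y) \<partial>lborel) = (\<integral>y. k (- x + y) \<partial>lborel)"
    using k(3)[of "x - _"] by (simp add: add.commute)
  then have one: "(\<integral>y. k (x - y) \<partial>lborel) = 1"
    using lborel_integral_translation[OF borel_measurable_continuous_onI[OF k(1)]] k(5) by metis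
  have "conv w k x - w x = (\<integral>y. w y * k (x - y) \<partial>lborel) - (\<integral>y. w x * k (x - y) \<partial>lborel)"
    using one by (simp add: conv_def)
  also have "\<dots> = (\<integral>y. (w y - w x) * k (x - y) \<partial>lborel)"
    using Bochner_Integration.integral_diff[OF iw integrable_mult_right[OF ik, of "w x"]] by (simp add: algebra_simps)
  finally have "\<bar>conv w k x - w x\<bar> \<le> (\<integral>y. \<bar>(w y - w x) * k (x - y)\<bar> \<partial>lborel)"
    by (metis integral_abs_bound)
  also have "\<dots> \<le> (\<integral>y. e * k (x - y) \<partial>lborel)"
  proof (rule integral_mono)
    show "integrable lborel (\<lambda>y. \<bar>(w y - w x) * k (x - y)\<bar>)"
      using integrable_abs[OF Bochner_Integration.integrable_diff[OF iw integrable_mult_right[OF ik, of "w x"]]]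
      by (simp add: algebra_simps)
    show "\<bar>(w y - w x) * k (x - y)\<bar> \<le> e * k (x - y)" for y
    proof (cases "norm (x - y) < d")
      case True
      then show ?thesis using osc[of y x] k(2)[of "x - y"] by (simp add: abs_mult norm_minus_commute mult_right_mono)
    qed (simp add: k(4))
  qed (use ik in simp)
  finally show ?thesis using one by simp
qed

text \<open>\<open>H10\<close> is defined through smooth test functions, whereas composing test
  functions with the nonlinearities of the proof gives C^1 functions only. Mollification bridges the
  gap, uniformly for values and gradients.\<close>

lemma C1_approx_by_test_fn:
  fixes w :: "'a::euclidean_space \<Rightarrow> real"
  assumes \<Omega>: "open \<Omega>" "K \<subseteq> \<Omega>" and w: "Ck (Suc 0) w" "compact K" "\<And>x. x \<notin> K \<Longrightarrow> w x = 0"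
    and e: "e > 0"
  obtains \<phi> where "test_fn \<Omega> \<phi>" "\<And>x. \<bar>\<phi> x - w x\<bar> \<le> e" "\<And>x. norm (grad \<phi> x - grad w x) \<le> e"
proof -
  have K: "closed K" by (rule compact_imp_closed[OF w(2)])
  obtain r where r: "r > 0" "(\<Union>x\<in>K. cball x r) \<subseteq> \<Omega>"
    using compact_subset_open_imp_cball_epsilon_subset[OF w(2) \<Omega>] by blast
  \<comment> \<open>The norm of the gradient error is estimated by the sum of its coordinates, of
    which there are \<open>DIM('a)\<close>.\<close>
  define c where "c = e / real DIM('a)"
  have "1 \<le> real DIM('a)" using DIM_positive[where 'a = 'a] by linarith
  then have c: "c > 0" "c \<le> e" unfolding c_def using e divide_left_mono[of 1 "real DIM('a)" e] by auto
  obtain R where R: "\<And>x. x \<in> K \<Longrightarrow> norm x \<le> R"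
    using compact_imp_bounded[OF w(2)] bounded_iff by metis
  have uc: "\<exists>d>0. \<forall>x y. norm (x - y) < d \<longrightarrow> \<bar>f x - f y\<bar> \<le> c"
    if f: "continuous_on UNIV f" "\<And>x. x \<notin> K \<Longrightarrow> f x = 0" for f :: "'a \<Rightarrow> real"
  proof -
    have "uniformly_continuous_on (cball 0 (R + 1)) f"
      by (rule compact_uniformly_continuous) (auto intro: continuous_on_subset[OF f(1)])
    then obtain d where d: "d > 0"
      "\<And>x y. norm x \<le> R + 1 \<Longrightarrow> norm y \<le> R + 1 \<Longrightarrow> norm (x - y) < d \<Longrightarrow> \<bar>f x - f y\<bar> < c"
      using c(1) unfolding uniformly_continuous_on_def dist_norm real_norm_def
      by (metis mem_cball_0 norm_minus_commute)
    \<comment> \<open>If one point lies in \<open>K\<close>, then distance below 1 puts both into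
      the ball of radius \<open>R + 1\<close>, where uniform continuity is known; otherwise both
      values are 0.\<close>
    have "\<bar>f x - f y\<bar> \<le> c" if xy: "norm (x - y) < min d 1" for x y
    proof (cases "x \<in> K \<or> y \<in> K")
      case True
      have "norm x \<le> norm y + norm (x - y)" "norm y \<le> norm x + norm (x - y)"
        using norm_triangle_sub[of x y] norm_triangle_sub[of y x] by (auto simp: norm_minus_commute)
      then have "norm x \<le> R + 1" "norm y \<le> R + 1" using True R[of x] R[of y] xy by auto
      then show ?thesis using d(2)[of x y] xy by auto
    qed (use c f in auto)
    then show ?thesis using d(1) by (intro exI[of _ "min d 1"]) auto
  qed
  have cw: "continuous_on UNIV w" by (rule Ck_continuous[OF w(1)])
  obtain d0 where d0: "d0 > 0" "\<And>x y. norm (x - y) < d0 \<Longrightarrow> \<bar>w x - w y\<bar> \<le> c"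
    using uc[OF cw w(3)] by blast
  have "\<forall>i\<in>Basis. \<exists>d>0. \<forall>x y. norm (x - y) < d \<longrightarrow> \<bar>pdiff w i x - pdiff w i y\<bar> \<le> c"
    using uc[OF Ck_Suc_continuous_pdiff[OF w(1)] pdiff_zero_off_closed[OF K w(3)]] by blast
  then obtain D where D: "\<And>i. i \<in> Basis \<Longrightarrow> D i > 0"
    "\<And>i x y. i \<in> Basis \<Longrightarrow> norm (x - y) < D i \<Longrightarrow> \<bar>pdiff w i x - pdiff w i y\<bar> \<le> c"
    by metis
  \<comment> \<open>A single radius serves \<open>w\<close> and all its partial derivatives, and
    \<open>d \<le> r\<close> keeps the support of the mollified function within distance
    \<open>r\<close> of \<open>K\<close>, hence inside \<Omega>.\<close>
  define d where "d = Min ({d0, r} \<union> D ` Basis)"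
  have d: "d > 0" "d \<le> d0" "d \<le> r" "\<And>i. i \<in> Basis \<Longrightarrow> d \<le> D i"
    unfolding d_def using d0 D r by (auto simp: min_le_iff_disj)
  obtain \<eta> :: "'a \<Rightarrow> real" where \<eta>: "smooth \<eta>" "\<And>x. \<eta> x \<ge> 0" "\<And>x. \<eta> (- x) = \<eta> x"
    "\<And>x. norm x \<ge> d \<Longrightarrow> \<eta> x = 0" "integral\<^sup>L lborel \<eta> = 1"
    using mollifier_exists[OF d(1)] by metis
  have C\<eta>: "Ck k \<eta>" for k using \<eta>(1) by (simp add: smooth_def)
  note c\<eta> = Ck_continuous[OF C\<eta>[of 0], of UNIV]
  define Kr where "Kr = {x + y |x y. x \<in> K \<and> y \<in> cball 0 r}"
  have Kr: "compact Kr" unfolding Kr_def by (rule compact_sums[OF w(2)]) auto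
  have "Kr \<subseteq> \<Omega>" using r(2) by (force simp: Kr_def dist_norm)
  have off: "conv w \<eta> x = 0" if "x \<notin> Kr" for x
  proof -
    have "w y * \<eta> (x - y) = 0" for y
    proof (cases "y \<in> K")
      case True
      have "\<not> norm (x - y) \<le> r"
      proof
        assume "norm (x - y) \<le> r"
        then have "x \<in> Kr" unfolding Kr_def using True
          by (intro CollectI exI[of _ y] exI[of _ "x - y"]) auto
        then show False using that by simp
      qed
      then show ?thesis using \<eta>(4)[of "x - y"] d by simp
    qed (simp add: w(3))
    then show ?thesis unfolding conv_def by (simp only: integral_zero)
  qed
  have sub: "{x. conv w \<eta> x \<noteq> 0} \<subseteq> Kr" using off by blast
  then have cl: "closure {x. conv w \<eta> x \<noteq> 0} \<subseteq> Kr"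
    by (rule closure_minimal) (use Kr compact_imp_closed in auto)
  show thesis
  proof (rule that[of "conv w \<eta>"])
    show "test_fn \<Omega> (conv w \<eta>)"
      unfolding test_fn_def smooth_def
      using Ck_conv[OF cw w(2,3) C\<eta>] cl \<open>Kr \<subseteq> \<Omega>\<close> bounded_subset[OF compact_imp_bounded[OF Kr] sub]
      by (auto simp: compact_closure)
    show "\<bar>conv w \<eta> x - w x\<bar> \<le> e" for x
    proof -
      have "\<bar>conv w \<eta> x - w x\<bar> \<le> c"
        by (rule conv_approx[OF cw w(2,3) c\<eta> \<eta>(2-5)]) (use d0(2) d(2) in auto)
      then show ?thesis using c by simp
    qed
    show "norm (grad (conv w \<eta>) x - grad w x) \<le> e" for x
    proof -
      have "\<bar>(grad (conv w \<eta>) x - grad w x) \<bullet> i\<bar> \<le> c" if i: "i \<in> Basis" for i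
        unfolding inner_diff_left grad_inner_Basis[OF i] pdiff_conv[OF w(1) w(2) w(3) C\<eta>[of "Suc 0"] i, simplified]
        by (rule conv_approx[OF Ck_Suc_continuous_pdiff[OF w(1) i] w(2) pdiff_zero_off_closed[OF K w(3)] c\<eta> \<eta>(2-5)])
           (use D(2)[OF i] d(4)[OF i] in auto)
      then have "(\<Sum>i\<in>Basis. \<bar>(grad (conv w \<eta>) x - grad w x) \<bullet> i\<bar>) \<le> (\<Sum>i\<in>(Basis::'a set). c)"
        by (rule sum_mono)
      then show ?thesis using norm_le_l1[of "grad (conv w \<eta>) x - grad w x"] by (simp add: c_def)
    qed
  qed
qed

section \<open>Square-integrable functions and the space H10\<close>

text \<open>\<open>L2\<close> for an arbitrary measure, so that the Hilbert space estimates can be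
  done without indicator functions; \<open>L2_eq\<close> translates.\<close>

definition sq_int :: "'a measure \<Rightarrow> ('a \<Rightarrow> 'b::euclidean_space) \<Rightarrow> bool" where
  "sq_int M v \<longleftrightarrow> v \<in> borel_measurable M \<and> integrable M (\<lambda>x. (norm (v x))\<^sup>2)"

lemma norm_add_sq_le: "(norm (a + b))\<^sup>2 \<le> 2 * (norm a)\<^sup>2 + 2 * (norm b)\<^sup>2"
  for a b :: "'b::real_normed_vector"
proof -
  have "(norm (a + b))\<^sup>2 \<le> (norm a + norm b)\<^sup>2" by (intro power_mono norm_triangle_ineq) auto
  also have "\<dots> \<le> 2 * (norm a)\<^sup>2 + 2 * (norm b)\<^sup>2" 
    using sum_squares_bound[of "norm a" "norm b"] by (simp add: power2_sum)
  finally show ?thesis .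
qed

lemma sq_int_add:
  assumes "sq_int M v" "sq_int M w" shows "sq_int M (\<lambda>x. v x + w x)"
proof -
  have [measurable]: "v \<in> borel_measurable M" "w \<in> borel_measurable M" using assms by (auto simp: sq_int_def)
  have "integrable M (\<lambda>x. 2 * (norm (v x))\<^sup>2 + 2 * (norm (w x))\<^sup>2)" using assms by (auto simp: sq_int_def)
  then have "integrable M (\<lambda>x. (norm (v x + w x))\<^sup>2)"
    by (rule Bochner_Integration.integrable_bound) (auto intro!: AE_I2 order_trans[OF norm_add_sq_le])
  then show ?thesis by (simp add: sq_int_def)
qed

lemma sq_int_bounded_scale:
  assumes "sq_int M v" and c[measurable]: "c \<in> borel_measurable M" and B: "AE x in M. \<bar>c x\<bar> \<le> B"
  shows "sq_int M (\<lambda>x. c x *\<^sub>R v x)"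
proof -
  have [measurable]: "v \<in> borel_measurable M" using assms by (auto simp: sq_int_def)
  have "integrable M (\<lambda>x. B\<^sup>2 * (norm (v x))\<^sup>2)" using assms by (auto simp: sq_int_def)
  then have "integrable M (\<lambda>x. (norm (c x *\<^sub>R v x))\<^sup>2)"
    by (rule Bochner_Integration.integrable_bound)
       (use B in \<open>auto simp: power_mult_distrib abs_le_square_iff intro!: mult_right_mono power2_le_iff_abs_le[THEN iffD2] elim!: eventually_mono\<close>)
  then show ?thesis by (simp add: sq_int_def)
qed

lemma sq_int_uminus: "sq_int M v \<Longrightarrow> sq_int M (\<lambda>x. - v x)"
  by (simp add: sq_int_def)

lemma sq_int_diff: "sq_int M v \<Longrightarrow> sq_int M w \<Longrightarrow> sq_int M (\<lambda>x. v x - w x)"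
  using sq_int_add[OF _ sq_int_uminus] by force

lemma sq_int_inner:
  assumes "sq_int M v" "sq_int M w" shows "integrable M (\<lambda>x. v x \<bullet> w x)"
proof -
  have [measurable]: "v \<in> borel_measurable M" "w \<in> borel_measurable M" using assms by (auto simp: sq_int_def)
  have "integrable M (\<lambda>x. (norm (v x))\<^sup>2 + (norm (w x))\<^sup>2)" using assms by (auto simp: sq_int_def)
  then show ?thesis
  proof (rule Bochner_Integration.integrable_bound)
    show "AE x in M. norm (v x \<bullet> w x) \<le> norm ((norm (v x))\<^sup>2 + (norm (w x))\<^sup>2)"
    proof (intro AE_I2)
      fix x
      have "norm (v x \<bullet> w x) \<le> norm (v x) * norm (w x)" using Cauchy_Schwarz_ineq2 by simp
      also have "\<dots> \<le> 2 * norm (v x) * norm (w x)" by simp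
      also have "\<dots> \<le> (norm (v x))\<^sup>2 + (norm (w x))\<^sup>2" by (rule sum_squares_bound)
      finally show "norm (v x \<bullet> w x) \<le> norm ((norm (v x))\<^sup>2 + (norm (w x))\<^sup>2)" by simp
    qed
  qed simp
qed

lemma (in finite_measure) sq_int_bounded:
  assumes "v \<in> borel_measurable M" "AE x in M. norm (v x) \<le> B"
  shows "sq_int M v"
proof -
  have "integrable M (\<lambda>x. (norm (v x))\<^sup>2)"
    by (rule integrable_const_bound[where B = "B\<^sup>2"]) (use assms in \<open>auto intro: power_mono elim!: eventually_mono\<close>)
  then show ?thesis using assms by (simp add: sq_int_def)
qed

text \<open>The integral of |v + t w|^2 is a nonnegative polynomial in t. Evaluate it at its
  minimiser -B/D; if D = 0 it is affine, and B \<noteq> 0 would allow the value -1.\<close>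

lemma integral_Cauchy_Schwarz:
  assumes "sq_int M v" "sq_int M w"
  shows "(\<integral>x. v x \<bullet> w x \<partial>M)\<^sup>2 \<le> (\<integral>x. (norm (v x))\<^sup>2 \<partial>M) * (\<integral>x. (norm (w x))\<^sup>2 \<partial>M)"
proof -
  define A B D where "A = (\<integral>x. (norm (v x))\<^sup>2 \<partial>M)" and "B = (\<integral>x. v x \<bullet> w x \<partial>M)" and "D = (\<integral>x. (norm (w x))\<^sup>2 \<partial>M)"
  have i: "integrable M (\<lambda>x. (norm (v x))\<^sup>2)" "integrable M (\<lambda>x. (norm (w x))\<^sup>2)" "integrable M (\<lambda>x. v x \<bullet> w x)"
    using assms sq_int_inner[OF assms] by (auto simp: sq_int_def)
  have q: "0 \<le> A + 2 * t * B + t\<^sup>2 * D" for t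
  proof -
    have "0 \<le> (\<integral>x. (norm (v x + t *\<^sub>R w x))\<^sup>2 \<partial>M)" by (intro integral_nonneg_AE) auto
    also have "(\<lambda>x. (norm (v x + t *\<^sub>R w x))\<^sup>2) = (\<lambda>x. (norm (v x))\<^sup>2 + (2 * t) * (v x \<bullet> w x) + t\<^sup>2 * (norm (w x))\<^sup>2)"
      by (simp only: fun_eq_iff power2_norm_eq_inner inner_add_left inner_add_right inner_scaleR_left inner_scaleR_right inner_commute)
         (simp add: power2_eq_square inner_commute algebra_simps)
    also have "(\<integral>x. (norm (v x))\<^sup>2 + (2 * t) * (v x \<bullet> w x) + t\<^sup>2 * (norm (w x))\<^sup>2 \<partial>M) = A + (2 * t) * B + t\<^sup>2 * D"
      using i by (simp add: A_def B_def D_def)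
    finally show ?thesis by simp
  qed
  have "D \<ge> 0" unfolding D_def by (intro integral_nonneg_AE) auto
  have "B\<^sup>2 \<le> A * D"
  proof (cases "D = 0")
    case True
    have "B = 0"
    proof (rule ccontr)
      assume "B \<noteq> 0"
      with q[of "- (A + 1) / (2 * B)"] True show False by (simp add: field_simps)
    qed
    then show ?thesis using True by simp
  next
    case False
    then have "D > 0" using \<open>D \<ge> 0\<close> by simp
    have "A + 2 * (- B / D) * B + (- B / D)\<^sup>2 * D = A - B\<^sup>2 / D"
      using False by (simp add: power2_eq_square field_simps)
    then have "B\<^sup>2 / D \<le> A" using q[of "- B / D"] by simp
    then show ?thesis using \<open>D > 0\<close> by (simp add: field_simps)
  qed
  then show ?thesis by (simp add: A_def B_def D_def)
qed

lemma sq_int_inner_tendsto: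
  assumes X: "sq_int M X" and v: "\<And>n. sq_int M (v n)" "sq_int M w"
    and lim: "(\<lambda>n::nat. \<integral>x. (norm (v n x - w x))\<^sup>2 \<partial>M) \<longlonglongrightarrow> 0"
  shows "(\<lambda>n. \<integral>x. X x \<bullet> v n x \<partial>M) \<longlonglongrightarrow> (\<integral>x. X x \<bullet> w x \<partial>M)"
proof -
  define A where "A = (\<integral>x. (norm (X x))\<^sup>2 \<partial>M)"
  have bound: "norm ((\<integral>x. X x \<bullet> v n x \<partial>M) - (\<integral>x. X x \<bullet> w x \<partial>M)) \<le> sqrt (A * (\<integral>x. (norm (v n x - w x))\<^sup>2 \<partial>M))" for n
  proof -
    have "(\<integral>x. X x \<bullet> v n x \<partial>M) - (\<integral>x. X x \<bullet> w x \<partial>M) = (\<integral>x. X x \<bullet> (v n x - w x) \<partial>M)"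
      using sq_int_inner[OF X v(1)[of n]] sq_int_inner[OF X v(2)] by (simp add: inner_diff_right)
    then show ?thesis
      using real_sqrt_le_mono[OF integral_Cauchy_Schwarz[OF X sq_int_diff[OF v(1)[of n] v(2)]]]
      by (simp add: A_def)
  qed
  have "(\<lambda>n. sqrt (A * (\<integral>x. (norm (v n x - w x))\<^sup>2 \<partial>M))) \<longlonglongrightarrow> 0"
    using lim by (auto intro!: tendsto_eq_intros)
  then have "(\<lambda>n. (\<integral>x. X x \<bullet> v n x \<partial>M) - (\<integral>x. X x \<bullet> w x \<partial>M)) \<longlonglongrightarrow> 0"
    by (rule Lim_null_comparison[OF always_eventually, rotated]) (intro allI bound)
  then show ?thesis by (simp add: LIM_zero_iff)
qed

section \<open>Weak gradients and \<open>H10\<close> over the restricted, finite measure on a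
  bounded open set\<close>

locale bounded_domain =
  fixes \<Omega> :: "'a::euclidean_space set"
  assumes op: "open \<Omega>" and bdd: "bounded \<Omega>"
begin

abbreviation "M \<equiv> lebesgue_on \<Omega>"

lemma lmeas: "\<Omega> \<in> lmeasurable"
  using op bdd by (rule lmeasurable_open[rotated])

lemma sets_lebesgue: "\<Omega> \<in> sets lebesgue" "\<Omega> \<inter> space lebesgue \<in> sets lebesgue"
  using lmeas by auto

sublocale finite_measure M
  using lmeas by (rule finite_measure_lebesgue_on)

lemma LINT_eq: "(LINT x:\<Omega>|lebesgue. q x) = integral\<^sup>L M q"
  for q :: "'a \<Rightarrow> 'b::{banach, second_countable_topology}"
  unfolding set_lebesgue_integral_def by (rule integral_restrict_space[OF sets_lebesgue(2), symmetric])

lemma set_integrable_eq: "set_integrable lebesgue \<Omega> q \<longleftrightarrow> integrable M q"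
  for q :: "'a \<Rightarrow> 'b::{banach, second_countable_topology}"
  unfolding set_integrable_def by (rule integrable_restrict_space[OF sets_lebesgue(2), symmetric])

lemma set_borel_measurable_eq: "set_borel_measurable lebesgue \<Omega> q \<longleftrightarrow> q \<in> borel_measurable M"
  for q :: "'a \<Rightarrow> 'b::real_normed_vector"
  unfolding set_borel_measurable_def by (rule borel_measurable_restrict_space_iff[OF sets_lebesgue(2), symmetric])

lemma AE_eq: "(AE x in lebesgue. x \<in> \<Omega> \<longrightarrow> P x) \<longleftrightarrow> (AE x in M. P x)"
  by (rule AE_restrict_space_iff[OF sets_lebesgue(2), symmetric])

lemma L2_eq: "L2 \<Omega> v \<longleftrightarrow> sq_int M v"
  by (simp add: L2_def sq_int_def set_integrable_eq set_borel_measurable_eq)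

lemma continuous_measurable: "continuous_on UNIV q \<Longrightarrow> q \<in> borel_measurable M"
  for q :: "'a \<Rightarrow> 'b::euclidean_space"
  by (rule continuous_imp_measurable_on_sets_lebesgue[OF continuous_on_subset sets_lebesgue(1)]) auto

lemma continuous_sq_int:
  fixes q :: "'a \<Rightarrow> 'b::euclidean_space"
  assumes "continuous_on UNIV q" shows "sq_int M q"
proof -
  have "compact (q ` closure \<Omega>)"
    using bdd by (intro compact_continuous_image continuous_on_subset[OF assms]) (auto simp: compact_closure)
  then obtain B where "\<forall>y\<in>q ` closure \<Omega>. norm y \<le> B" by (meson bounded_iff compact_imp_bounded)
  then show ?thesis
    using closure_subset[of \<Omega>]
    by (intro sq_int_bounded[OF continuous_measurable[OF assms], of B] AE_I2) auto
qed

lemma integral_compact_support: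
  fixes q :: "'a \<Rightarrow> real"
  assumes "continuous_on UNIV q" "K \<subseteq> \<Omega>" "\<And>x. x \<notin> K \<Longrightarrow> q x = 0"
  shows "integral\<^sup>L M q = integral\<^sup>L lborel q"
proof -
  have "integral\<^sup>L M q = integral\<^sup>L lebesgue (\<lambda>x. indicator \<Omega> x *\<^sub>R q x)"
    by (rule integral_restrict_space[OF sets_lebesgue(2)])
  also have "(\<lambda>x. indicator \<Omega> x *\<^sub>R q x) = q" using assms by (force simp: indicator_def fun_eq_iff)
  also have "integral\<^sup>L lebesgue q = integral\<^sup>L lborel q"
    by (rule integral_completion) (use assms(1) borel_measurable_continuous_onI in auto)
  finally show ?thesis .
qed

lemma test_fn_support:
  assumes "test_fn \<Omega> \<phi>"
  obtains K where "compact K" "K \<subseteq> \<Omega>" "\<And>x. x \<notin> K \<Longrightarrow> \<phi> x = 0" "\<And>k. Ck k \<phi>"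
  using assms closure_subset[of "{x. \<phi> x \<noteq> 0}"] unfolding test_fn_def smooth_def
  by (intro that[of "closure {x. \<phi> x \<noteq> 0}"]) auto

text \<open>No boundary term arises although \<open>X\<close> need not vanish on the boundary,
  because the approximations of \<open>w\<close> have compact support; both sides pass to the limit
  by L^2 convergence. The approximations are only C^1, since the lemma is also used to obtain the
  weak gradient in \<open>H10I\<close>.\<close>

lemma integration_by_parts_limit:
  assumes X: "Ck (Suc 0) X" and i: "i \<in> Basis"
    and wn: "\<And>n. Ck (Suc 0) (wn n)" "\<And>n. compact (K n)" "\<And>n. K n \<subseteq> \<Omega>" "\<And>n x. x \<notin> K n \<Longrightarrow> wn n x = 0"
    and w: "sq_int M w" and g: "sq_int M g"
    and lim: "(\<lambda>n::nat. \<integral>x. (norm (wn n x - w x))\<^sup>2 \<partial>M) \<longlonglongrightarrow> 0"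
      "(\<lambda>n. \<integral>x. (norm (grad (wn n) x - g x))\<^sup>2 \<partial>M) \<longlonglongrightarrow> 0"
  shows "(\<integral>x. X x * (g x \<bullet> i) \<partial>M) = - (\<integral>x. pdiff X i x * w x \<partial>M)"
proof -
  have cX: "continuous_on UNIV X" "continuous_on UNIV (pdiff X i)"
    using Ck_continuous[OF X] Ck_Suc_continuous_pdiff[OF X i] by auto
  have cw: "continuous_on UNIV (wn n)" "continuous_on UNIV (pdiff (wn n) i)" for n
    using Ck_continuous[OF wn(1)] Ck_Suc_continuous_pdiff[OF wn(1) i] by auto
  have "(\<lambda>n. \<integral>x. (X x *\<^sub>R i) \<bullet> grad (wn n) x \<partial>M) \<longlonglongrightarrow> (\<integral>x. (X x *\<^sub>R i) \<bullet> g x \<partial>M)"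
    by (rule sq_int_inner_tendsto[OF continuous_sq_int continuous_sq_int g lim(2)])
       (intro continuous_intros cX Ck_Suc_continuous_grad[OF wn(1)])+
  then have 1: "(\<lambda>n. \<integral>x. X x * pdiff (wn n) i x \<partial>M) \<longlonglongrightarrow> (\<integral>x. X x * (g x \<bullet> i) \<partial>M)"
    by (simp add: inner_commute[of i] grad_inner_Basis[OF i])
  have "(\<lambda>n. \<integral>x. pdiff X i x \<bullet> wn n x \<partial>M) \<longlonglongrightarrow> (\<integral>x. pdiff X i x \<bullet> w x \<partial>M)"
    by (rule sq_int_inner_tendsto[OF continuous_sq_int[OF cX(2)] continuous_sq_int[OF cw(1)] w lim(1)])
  then have 2: "(\<lambda>n. - (\<integral>x. pdiff X i x * wn n x \<partial>M)) \<longlonglongrightarrow> - (\<integral>x. pdiff X i x * w x \<partial>M)"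
    by (intro tendsto_minus) simp
  have "(\<integral>x. X x * pdiff (wn n) i x \<partial>M) = - (\<integral>x. pdiff X i x * wn n x \<partial>M)" for n
    using integration_by_parts_compact_support[OF X wn(1,2,4) i, of n]
      integral_compact_support[OF continuous_on_mult[OF cX(1) cw(2)] wn(3), of n]
      integral_compact_support[OF continuous_on_mult[OF cX(2) cw(1)] wn(3), of n]
      pdiff_zero_off_closed[OF compact_imp_closed[OF wn(2)] wn(4)] wn(4) by simp
  then show ?thesis using LIMSEQ_unique[OF 1] 2 by simp
qed

lemma H10_iff:
  "H10 \<Omega> u g \<longleftrightarrow> sq_int M u \<and> sq_int M g \<and> weak_grad \<Omega> u g \<and>
     (\<exists>\<phi>s. (\<forall>n. test_fn \<Omega> (\<phi>s n)) \<and>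
        (\<lambda>n. \<integral>x. (norm (\<phi>s n x - u x))\<^sup>2 \<partial>M) \<longlonglongrightarrow> 0 \<and>
        (\<lambda>n. \<integral>x. (norm (grad (\<phi>s n) x - g x))\<^sup>2 \<partial>M) \<longlonglongrightarrow> 0)"
  by (simp add: H10_def L2_eq LINT_eq)

text \<open>\<open>weak_grad\<close> alone covers only test functions. The comparison proof needs
  components of grad(v(U)), which have no compact support and are only C^1.\<close>

lemma H10_integration_by_parts:
  assumes "H10 \<Omega> w g" "Ck (Suc 0) X" "i \<in> Basis"
  shows "(\<integral>x. X x * (g x \<bullet> i) \<partial>M) = - (\<integral>x. pdiff X i x * w x \<partial>M)"
proof -
  from assms(1) obtain \<phi> where \<phi>: "\<And>n. test_fn \<Omega> (\<phi> n)" "sq_int M w" "sq_int M g"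
    "(\<lambda>n. \<integral>x. (norm (\<phi> n x - w x))\<^sup>2 \<partial>M) \<longlonglongrightarrow> 0"
    "(\<lambda>n. \<integral>x. (norm (grad (\<phi> n) x - g x))\<^sup>2 \<partial>M) \<longlonglongrightarrow> 0" by (auto simp: H10_iff)
  have "\<forall>n. \<exists>K. compact K \<and> K \<subseteq> \<Omega> \<and> (\<forall>x. x \<notin> K \<longrightarrow> \<phi> n x = 0)" using test_fn_support[OF \<phi>(1)] by metis
  then obtain K where K: "\<And>n. compact (K n)" "\<And>n. K n \<subseteq> \<Omega>" "\<And>n x. x \<notin> K n \<Longrightarrow> \<phi> n x = 0" by metis
  have C: "Ck (Suc 0) (\<phi> n)" for n using test_fn_support[OF \<phi>(1)] by metis
  show ?thesis by (rule integration_by_parts_limit[OF assms(2,3) C K \<phi>(2-5)])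
qed

text \<open>Replace the n-th C^1 approximation by a test function that is uniformly within 1/(n+1)
  of it, gradients included. On a set of finite measure this uniform error is negligible in
  L^2.\<close>

lemma H10I:
  assumes wn: "\<And>n. Ck (Suc 0) (wn n)" "\<And>n. compact (K n)" "\<And>n. K n \<subseteq> \<Omega>" "\<And>n x. x \<notin> K n \<Longrightarrow> wn n x = 0"
    and w: "sq_int M w" and g: "sq_int M g"
    and lim: "(\<lambda>n::nat. \<integral>x. (norm (wn n x - w x))\<^sup>2 \<partial>M) \<longlonglongrightarrow> 0"
      "(\<lambda>n. \<integral>x. (norm (grad (wn n) x - g x))\<^sup>2 \<partial>M) \<longlonglongrightarrow> 0"
  shows "H10 \<Omega> w g"
proof -
  define e where "e = (\<lambda>n. 1 / real (Suc n))"
  have e0: "e n > 0" for n by (simp add: e_def)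
  have elim: "e \<longlonglongrightarrow> 0" unfolding e_def using LIMSEQ_inverse_real_of_nat by (simp add: inverse_eq_divide)
  have "\<exists>\<phi>. test_fn \<Omega> \<phi> \<and> (\<forall>x. \<bar>\<phi> x - wn n x\<bar> \<le> e n) \<and> (\<forall>x. norm (grad \<phi> x - grad (wn n) x) \<le> e n)" for n
    using C1_approx_by_test_fn[OF op wn(3,1,2,4) e0, of n n] by metis
  then obtain \<phi> where \<phi>: "\<And>n. test_fn \<Omega> (\<phi> n)" "\<And>n x. norm (\<phi> n x - wn n x) \<le> e n"
      "\<And>n x. norm (grad (\<phi> n) x - grad (wn n) x) \<le> e n" unfolding real_norm_def by metis
  have C: "Ck (Suc 0) (\<phi> n)" for n using test_fn_support[OF \<phi>(1)] by metis
  \<comment> \<open>Stated for a general target space, so that it applies to the functions and to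
    their gradients.\<close>
  have perturb: "(\<lambda>n. \<integral>x. (norm (p n x - v x))\<^sup>2 \<partial>M) \<longlonglongrightarrow> 0"
    if p: "\<And>n. continuous_on UNIV (p n)" "\<And>n. continuous_on UNIV (q n)" "sq_int M v"
      "\<And>n x. norm (p n x - q n x) \<le> e n" "(\<lambda>n. \<integral>x. (norm (q n x - v x))\<^sup>2 \<partial>M) \<longlonglongrightarrow> 0"
    for p q :: "nat \<Rightarrow> 'a \<Rightarrow> 'b::euclidean_space" and v
  proof (rule tendsto_sandwich[OF _ _ tendsto_const])
    let ?b = "\<lambda>n. 2 * (e n)\<^sup>2 * measure M (space M) + 2 * (\<integral>x. (norm (q n x - v x))\<^sup>2 \<partial>M)"
    show "?b \<longlonglongrightarrow> 0" using elim p(5) by (auto intro!: tendsto_eq_intros)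
    show "\<forall>\<^sub>F n in sequentially. (\<integral>x. (norm (p n x - v x))\<^sup>2 \<partial>M) \<le> ?b n"
    proof (intro always_eventually allI)
      fix n
      have sq: "sq_int M (\<lambda>x. p n x - v x)" "sq_int M (\<lambda>x. q n x - v x)"
        by (intro sq_int_diff continuous_sq_int p)+
      have "(\<integral>x. (norm (p n x - v x))\<^sup>2 \<partial>M) \<le> (\<integral>x. 2 * (e n)\<^sup>2 + 2 * (norm (q n x - v x))\<^sup>2 \<partial>M)"
      proof (rule integral_mono)
        fix x
        have "(norm (p n x - v x))\<^sup>2 \<le> 2 * (norm (p n x - q n x))\<^sup>2 + 2 * (norm (q n x - v x))\<^sup>2"
          using norm_add_sq_le[of "p n x - q n x" "q n x - v x"] by simp
        also have "(norm (p n x - q n x))\<^sup>2 \<le> (e n)\<^sup>2" by (intro power_mono p) auto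
        finally show "(norm (p n x - v x))\<^sup>2 \<le> 2 * (e n)\<^sup>2 + 2 * (norm (q n x - v x))\<^sup>2" by simp
      qed (use sq in \<open>auto simp: sq_int_def\<close>)
      also have "\<dots> = ?b n" using sq by (subst Bochner_Integration.integral_add) (auto simp: sq_int_def)
      finally show "(\<integral>x. (norm (p n x - v x))\<^sup>2 \<partial>M) \<le> ?b n" .
    qed
  qed (auto intro!: always_eventually integral_nonneg_AE)
  have "weak_grad \<Omega> w g"
    unfolding weak_grad_def LINT_eq
  proof (intro allI impI ballI)
    fix \<psi> and i :: 'a assume "test_fn \<Omega> \<psi>" and i: "i \<in> Basis"
    then have "Ck (Suc 0) \<psi>" using test_fn_support by metis
    from integration_by_parts_limit[OF this i wn w g lim]
    show "(\<integral>x. w x * pdiff \<psi> i x \<partial>M) = - (\<integral>x. g x \<bullet> i * \<psi> x \<partial>M)" by (simp add: mult.commute)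
  qed
  moreover have "(\<lambda>n. \<integral>x. (norm (\<phi> n x - w x))\<^sup>2 \<partial>M) \<longlonglongrightarrow> 0"
    by (rule perturb[OF Ck_continuous[OF C] Ck_continuous[OF wn(1)] w \<phi>(2) lim(1)])
  moreover have "(\<lambda>n. \<integral>x. (norm (grad (\<phi> n) x - g x))\<^sup>2 \<partial>M) \<longlonglongrightarrow> 0"
    by (rule perturb[OF Ck_Suc_continuous_grad[OF C] Ck_Suc_continuous_grad[OF wn(1)] g \<phi>(3) lim(2)])
  ultimately show ?thesis using w g \<phi>(1) unfolding H10_iff by blast
qed

end

section \<open>Superposition in H10\<close>

text \<open>
  A \<open>C\<^sup>1\<close> map that is the identity on \<open>[0, \<infinity>)\<close> and stays above \<open>- c\<close>. The smooth functions approximating a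
  nonnegative \<open>H10\<close> function may be negative; clamping them keeps the supports of the composed
  functions inside \<open>{U > - c}\<close>.
\<close>

definition soft_clamp :: "real \<Rightarrow> real \<Rightarrow> real" where
  "soft_clamp c s = s * (c / (c - min s 0))"

lemma soft_clamp_nonneg: "c > 0 \<Longrightarrow> s \<ge> 0 \<Longrightarrow> soft_clamp c s = s"
  by (simp add: soft_clamp_def)

lemma soft_clamp_gt:
  assumes "c > 0" shows "soft_clamp c s > - c"
proof (cases "s \<ge> 0")
  case False
  then have "s * c > - c * (c - s)" using assms by (simp add: algebra_simps)
  then show ?thesis using False assms by (simp add: soft_clamp_def field_simps)
qed (use assms in \<open>simp add: soft_clamp_nonneg\<close>)

lemma soft_clamp_deriv:
  assumes c: "c > 0"
  shows "(soft_clamp c has_real_derivative (c / (c - min s 0))\<^sup>2) (at s)"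
proof -
  consider "s < 0" | "s > 0" | "s = 0" by linarith
  then show ?thesis
  proof cases
    case 1
    have "((\<lambda>s. s * (c / (c - s))) has_real_derivative (c / (c - s))\<^sup>2) (at s)"
      using 1 c by (auto intro!: derivative_eq_intros simp: field_simps power2_eq_square)
    then show ?thesis using 1
      by (subst DERIV_cong_ev[OF refl _ refl, where g = "\<lambda>s. s * (c / (c - s))"])
         (use 1 eventually_nhds_in_open[of "{..<0}" s] in \<open>auto elim!: eventually_mono simp: soft_clamp_def\<close>)
  next
    case 2
    have "((\<lambda>s. s) has_real_derivative 1) (at s)" by simp
    then show ?thesis using 2 c
      by (subst DERIV_cong_ev[OF refl _ refl, where g = "\<lambda>s. s"])
         (use 2 eventually_nhds_in_open[of "{0<..}" s] in \<open>auto elim!: eventually_mono simp: soft_clamp_def\<close>)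
  next
    case 3
    have "isCont (\<lambda>s. c / (c - min s 0)) 0" using c by (intro continuous_intros) auto
    then have "((\<lambda>s. c / (c - min s 0)) \<longlongrightarrow> 1) (at 0)" using c by (simp add: isCont_def)
    then have "((\<lambda>s. soft_clamp c s / s) \<longlongrightarrow> 1) (at 0)"
      by (rule Lim_transform_eventually) (auto simp: eventually_at_filter soft_clamp_def)
    then show ?thesis using 3 c by (simp add: DERIV_def soft_clamp_def)
  qed
qed

lemma soft_clamp_deriv_continuous:
  assumes "c > 0" shows "continuous_on UNIV (\<lambda>s::real. (c / (c - min s 0))\<^sup>2)"
proof -
  have "c - min s 0 \<noteq> 0" for s using assms by auto
  then show ?thesis by (intro continuous_intros) auto
qed

lemma soft_clamp_deriv_le:
  fixes c s :: real
  assumes "c > 0" shows "\<bar>(c / (c - min s 0))\<^sup>2\<bar> \<le> 1"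
proof -
  have "0 \<le> c / (c - min s 0)" "c / (c - min s 0) \<le> 1" using assms by (auto simp: divide_le_eq)
  then show ?thesis by (simp add: power_le_one)
qed

lemma soft_clamp_continuous: "c > 0 \<Longrightarrow> continuous_on UNIV (soft_clamp c)"
  by (intro continuous_at_imp_continuous_on ballI DERIV_isCont[OF soft_clamp_deriv])

lemma continuous_on_prod_apply:
  fixes \<Psi> :: "real \<Rightarrow> real \<Rightarrow> real"
  assumes "continuous_on UNIV (\<lambda>z. \<Psi> (fst z) (snd z))" "continuous_on S a" "continuous_on S b"
  shows "continuous_on S (\<lambda>x. \<Psi> (a x) (b x))"
  using continuous_on_compose2[OF assms(1) continuous_on_Pair[OF assms(2,3)]] by simp

lemma measurable_prod_apply:
  fixes \<Psi> :: "real \<Rightarrow> real \<Rightarrow> real"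
  assumes "continuous_on UNIV (\<lambda>z. \<Psi> (fst z) (snd z))" "a \<in> borel_measurable N" "b \<in> borel_measurable N"
  shows "(\<lambda>x. \<Psi> (a x) (b x)) \<in> borel_measurable N"
  using measurable_compose[OF borel_measurable_Pair[OF assms(2,3)] borel_measurable_continuous_onI[OF assms(1)]] by simp

text \<open>There is no lower bound for \<open>r\<close> and no upper bound for \<open>t\<close>.
  But \<Psi> can be nonzero only where t < r, and this forces both variables into the compact
  interval [a, b].\<close>

lemma bounded_above_diagonal:
  fixes \<Psi> :: "real \<Rightarrow> real \<Rightarrow> real"
  assumes c: "continuous_on UNIV (\<lambda>z. \<Psi> (fst z) (snd z))" and z: "\<And>r t. r \<le> t \<Longrightarrow> \<Psi> r t = 0"
  obtains B where "B \<ge> 0" "\<And>r t. r \<le> b \<Longrightarrow> t \<ge> a \<Longrightarrow> \<bar>\<Psi> r t\<bar> \<le> B"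
proof -
  have "compact ((\<lambda>z. \<Psi> (fst z) (snd z)) ` ({a..b} \<times> {a..b}))"
    by (intro compact_continuous_image continuous_on_subset[OF c] compact_Times) auto
  then obtain B where B: "\<forall>y\<in>(\<lambda>z. \<Psi> (fst z) (snd z)) ` ({a..b} \<times> {a..b}). norm y \<le> B"
    by (meson bounded_iff compact_imp_bounded)
  show thesis
  proof (rule that[of "max 0 B"])
    fix r t assume "r \<le> b" "t \<ge> a"
    then show "\<bar>\<Psi> r t\<bar> \<le> max 0 B"
    proof (cases "r \<le> t")
      case False
      then have "(r, t) \<in> {a..b} \<times> {a..b}" using \<open>r \<le> b\<close> \<open>t \<ge> a\<close> by auto
      then have "\<bar>\<Psi> r t\<bar> \<le> B" using B by force
      then show ?thesis by simp
    qed (simp add: z)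
  qed simp
qed

context bounded_domain
begin

text \<open>Nonlinear expressions in the approximations are handled by dominated convergence, which
  needs pointwise limits; a subsequence of an L^2 convergent sequence supplies them.\<close>

lemma H10_AE_approx:
  assumes "H10 \<Omega> u g"
  obtains \<phi> where "\<And>n::nat. test_fn \<Omega> (\<phi> n)" "AE x in M. (\<lambda>n. \<phi> n x) \<longlonglongrightarrow> u x"
    "(\<lambda>n. \<integral>x. (norm (grad (\<phi> n) x - g x))\<^sup>2 \<partial>M) \<longlonglongrightarrow> 0"
proof -
  from assms obtain \<phi> where \<phi>: "\<And>n. test_fn \<Omega> (\<phi> n)" "sq_int M u" "sq_int M g"
    "(\<lambda>n. \<integral>x. (norm (\<phi> n x - u x))\<^sup>2 \<partial>M) \<longlonglongrightarrow> 0"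
    "(\<lambda>n. \<integral>x. (norm (grad (\<phi> n) x - g x))\<^sup>2 \<partial>M) \<longlonglongrightarrow> 0" by (auto simp: H10_iff)
  have C: "Ck (Suc 0) (\<phi> n)" for n using test_fn_support[OF \<phi>(1)] by metis
  have "sq_int M (\<lambda>x. \<phi> n x - u x)" for n by (intro sq_int_diff continuous_sq_int Ck_continuous[OF C] \<phi>)
  then have i: "integrable M (\<lambda>x. (\<phi> n x - u x)\<^sup>2)" for n by (simp add: sq_int_def)
  obtain r where r: "strict_mono r" "AE x in M. (\<lambda>n. (\<phi> (r n) x - u x)\<^sup>2) \<longlonglongrightarrow> 0"
    using tendsto_L1_AE_subseq[where u = "\<lambda>n x. (\<phi> n x - u x)\<^sup>2", OF i] \<phi>(4) by auto
  show thesis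
  proof (rule that[of "\<lambda>n. \<phi> (r n)"])
    show "AE x in M. (\<lambda>n. \<phi> (r n) x) \<longlonglongrightarrow> u x"
      using r(2)
    proof (rule eventually_mono)
      fix x assume "(\<lambda>n. (\<phi> (r n) x - u x)\<^sup>2) \<longlonglongrightarrow> 0"
      then have "(\<lambda>n. sqrt ((\<phi> (r n) x - u x)\<^sup>2)) \<longlonglongrightarrow> sqrt 0" by (rule tendsto_real_sqrt)
      then show "(\<lambda>n. \<phi> (r n) x) \<longlonglongrightarrow> u x" by (simp add: tendsto_rabs_zero_iff LIM_zero_iff)
    qed
    show "(\<lambda>n. \<integral>x. (norm (grad (\<phi> (r n)) x - g x))\<^sup>2 \<partial>M) \<longlonglongrightarrow> 0"
      using LIMSEQ_subseq_LIMSEQ[OF \<phi>(5) r(1)] by (simp add: o_def)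
  qed (rule \<phi>(1))
qed

text \<open>The chain rule for \<Phi>(U, u). The approximations \<Phi>(U, \<kappa>(\<phi>)) with
  clamped test functions \<phi> are C^1, and outside \<open>K\<close> they vanish because U \<le>
  -c0 < \<kappa>(\<phi>) there. Vanishing of \<Phi> and its partial derivatives for r \<le> t also
  makes all coefficients bounded.\<close>

lemma H10_compose:
  fixes \<Phi> \<Phi>r \<Phi>t :: "real \<Rightarrow> real \<Rightarrow> real"
  assumes u: "H10 \<Omega> u g" "AE x in M. u x \<ge> 0"
    and D: "\<And>z. ((\<lambda>z. \<Phi> (fst z) (snd z)) has_derivative
        (\<lambda>d. \<Phi>r (fst z) (snd z) * fst d + \<Phi>t (fst z) (snd z) * snd d)) (at z)"
    and c: "continuous_on UNIV (\<lambda>z. \<Phi>r (fst z) (snd z))" "continuous_on UNIV (\<lambda>z. \<Phi>t (fst z) (snd z))"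
    and z: "\<And>r t. r \<le> t \<Longrightarrow> \<Phi> r t = 0" "\<And>r t. r \<le> t \<Longrightarrow> \<Phi>r r t = 0" "\<And>r t. r \<le> t \<Longrightarrow> \<Phi>t r t = 0"
    and U: "Ck (Suc 0) U" "\<And>x. U x \<le> b" "compact K" "K \<subseteq> \<Omega>" "\<And>x. x \<notin> K \<Longrightarrow> U x \<le> - c0" "c0 > 0"
  shows "H10 \<Omega> (\<lambda>x. \<Phi> (U x) (u x)) (\<lambda>x. \<Phi>r (U x) (u x) *\<^sub>R grad U x + \<Phi>t (U x) (u x) *\<^sub>R g x)" (is "H10 \<Omega> ?w ?\<psi>")
    and "ess_bounded \<Omega> (\<lambda>x. \<Phi> (U x) (u x))"
proof -
  have c\<Phi>: "continuous_on UNIV (\<lambda>z. \<Phi> (fst z) (snd z))"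
    using D has_derivative_continuous by (blast intro: continuous_at_imp_continuous_on)
  obtain B0 where B0: "B0 \<ge> 0" "\<And>r t. r \<le> b \<Longrightarrow> t \<ge> - c0 \<Longrightarrow> \<bar>\<Phi> r t\<bar> \<le> B0"
    using bounded_above_diagonal[where a = "- c0" and b = b, OF c\<Phi> z(1)] by blast
  obtain B1 where B1: "B1 \<ge> 0" "\<And>r t. r \<le> b \<Longrightarrow> t \<ge> - c0 \<Longrightarrow> \<bar>\<Phi>r r t\<bar> \<le> B1"
    using bounded_above_diagonal[where a = "- c0" and b = b, OF c(1) z(2)] by blast
  obtain B2 where B2: "B2 \<ge> 0" "\<And>r t. r \<le> b \<Longrightarrow> t \<ge> - c0 \<Longrightarrow> \<bar>\<Phi>t r t\<bar> \<le> B2"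
    using bounded_above_diagonal[where a = "- c0" and b = b, OF c(2) z(3)] by blast
  have su: "sq_int M u" "sq_int M g" using u(1) by (auto simp: H10_iff)
  have [measurable]: "u \<in> borel_measurable M" "g \<in> borel_measurable M" using su by (auto simp: sq_int_def)
  have cU: "continuous_on UNIV U" "continuous_on UNIV (grad U)"
    using Ck_continuous[OF U(1)] Ck_Suc_continuous_grad[OF U(1)] by auto
  have [measurable]: "U \<in> borel_measurable M" "grad U \<in> borel_measurable M"
    by (intro continuous_measurable cU)+
  have mw[measurable]: "?w \<in> borel_measurable M" by (rule measurable_prod_apply[OF c\<Phi>]) auto
  have mr[measurable]: "(\<lambda>x. \<Phi>r (U x) (u x)) \<in> borel_measurable M" by (rule measurable_prod_apply[OF c(1)]) auto
  have mt[measurable]: "(\<lambda>x. \<Phi>t (U x) (u x)) \<in> borel_measurable M" by (rule measurable_prod_apply[OF c(2)]) auto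
  have bw: "AE x in M. \<bar>\<Phi> (U x) (u x)\<bar> \<le> B0" "AE x in M. \<bar>\<Phi>r (U x) (u x)\<bar> \<le> B1" "AE x in M. \<bar>\<Phi>t (U x) (u x)\<bar> \<le> B2"
    using u(2) by (rule eventually_mono; use B0 B1 B2 U in force)+
  show "ess_bounded \<Omega> ?w" using bw(1) by (auto simp: ess_bounded_def set_borel_measurable_eq AE_eq)
  have sw: "sq_int M ?w" by (rule sq_int_bounded[OF mw]) (use bw in auto)
  have s\<psi>: "sq_int M ?\<psi>"
    by (intro sq_int_add sq_int_bounded_scale[OF continuous_sq_int[OF cU(2)] mr bw(2)] sq_int_bounded_scale[OF su(2) mt bw(3)])
  define \<kappa> where "\<kappa> = soft_clamp c0"
  define \<kappa>' where "\<kappa>' = (\<lambda>s. (c0 / (c0 - min s 0))\<^sup>2)"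
  have \<kappa>: "continuous_on UNIV \<kappa>" "\<And>s. \<kappa> s > - c0" "\<And>s. s \<ge> 0 \<Longrightarrow> \<kappa> s = s"
    using U(6) by (auto simp: \<kappa>_def soft_clamp_gt soft_clamp_nonneg soft_clamp_continuous)
  have \<kappa>': "continuous_on UNIV \<kappa>'" "\<And>s. \<bar>\<kappa>' s\<bar> \<le> 1" "\<And>s. s \<ge> 0 \<Longrightarrow> \<kappa>' s = 1"
    unfolding \<kappa>'_def using U(6) soft_clamp_deriv_continuous[OF U(6)] soft_clamp_deriv_le[OF U(6)] by (blast, blast, simp)
  have \<kappa>D: "(\<kappa> has_derivative (\<lambda>d. \<kappa>' s * d)) (at s)" for s
    using soft_clamp_deriv[OF U(6)] by (simp add: \<kappa>_def \<kappa>'_def has_field_derivative_def)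
  obtain \<phi> where \<phi>: "\<And>n::nat. test_fn \<Omega> (\<phi> n)" "AE x in M. (\<lambda>n. \<phi> n x) \<longlonglongrightarrow> u x"
    "(\<lambda>n. \<integral>x. (norm (grad (\<phi> n) x - g x))\<^sup>2 \<partial>M) \<longlonglongrightarrow> 0" using H10_AE_approx[OF u(1)] by blast
  have C: "Ck (Suc 0) (\<phi> n)" for n using test_fn_support[OF \<phi>(1)] by metis
  have c\<phi>: "continuous_on UNIV (\<phi> n)" "continuous_on UNIV (grad (\<phi> n))" for n
    using Ck_continuous[OF C] Ck_Suc_continuous_grad[OF C] by auto
  define wn where "wn = (\<lambda>n x. \<Phi> (U x) (\<kappa> (\<phi> n x)))"
  define an where "an = (\<lambda>n x. \<Phi>r (U x) (\<kappa> (\<phi> n x)))"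
  define bn where "bn = (\<lambda>n x. \<Phi>t (U x) (\<kappa> (\<phi> n x)) * \<kappa>' (\<phi> n x))"
  have c\<kappa>: "continuous_on UNIV (\<lambda>x. \<kappa> (\<phi> n x))" "continuous_on UNIV (\<lambda>x. \<kappa>' (\<phi> n x))" for n
    by (intro continuous_on_compose2[OF \<kappa>(1) c\<phi>(1)] continuous_on_compose2[OF \<kappa>'(1) c\<phi>(1)]; simp)+
  have can: "continuous_on UNIV (an n)" "continuous_on UNIV (bn n)" "continuous_on UNIV (wn n)" for n
    unfolding an_def bn_def wn_def
    by (rule continuous_on_prod_apply[OF c(1) cU(1) c\<kappa>(1)],
        rule continuous_on_mult[OF continuous_on_prod_apply[OF c(2) cU(1) c\<kappa>(1)] c\<kappa>(2)],
        rule continuous_on_prod_apply[OF c\<Phi> cU(1) c\<kappa>(1)])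
  have bn: "\<bar>wn n x\<bar> \<le> B0" "\<bar>an n x\<bar> \<le> B1" "\<bar>bn n x\<bar> \<le> B2" for n x
  proof -
    have k: "U x \<le> b" "\<kappa> (\<phi> n x) \<ge> - c0" using U(2) \<kappa>(2) less_imp_le by auto
    show "\<bar>wn n x\<bar> \<le> B0" "\<bar>an n x\<bar> \<le> B1" using B0(2)[OF k] B1(2)[OF k] by (auto simp: wn_def an_def)
    have "\<bar>\<Phi>t (U x) (\<kappa> (\<phi> n x))\<bar> * \<bar>\<kappa>' (\<phi> n x)\<bar> \<le> B2 * 1"
      by (intro mult_mono B2(2)[OF k] \<kappa>'(2) B2(1)) auto
    then show "\<bar>bn n x\<bar> \<le> B2" by (simp add: bn_def abs_mult)
  qed
  have Dw: "(wn n has_derivative (\<lambda>d. (an n x *\<^sub>R grad U x + bn n x *\<^sub>R grad (\<phi> n) x) \<bullet> d)) (at x)" for n x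
  proof -
    have "((\<lambda>x. (U x, \<kappa> (\<phi> n x))) has_derivative (\<lambda>d. (grad U x \<bullet> d, \<kappa>' (\<phi> n x) * (grad (\<phi> n) x \<bullet> d)))) (at x)"
      by (intro has_derivative_Pair Ck_has_derivative[OF U(1)] has_derivative_compose[OF Ck_has_derivative[OF C] \<kappa>D])
    from has_derivative_compose[OF this D]
    have "((\<lambda>x. \<Phi> (U x) (\<kappa> (\<phi> n x))) has_derivative (\<lambda>d. \<Phi>r (U x) (\<kappa> (\<phi> n x)) * (grad U x \<bullet> d) +
        \<Phi>t (U x) (\<kappa> (\<phi> n x)) * (\<kappa>' (\<phi> n x) * (grad (\<phi> n) x \<bullet> d)))) (at x)" by simp
    then show ?thesis unfolding wn_def an_def bn_def by (simp add: inner_add_left mult.assoc)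
  qed
  have gw: "grad (wn n) x = an n x *\<^sub>R grad U x + bn n x *\<^sub>R grad (\<phi> n) x" for n x
    by (rule grad_eqI[OF Dw])
  have Cw: "Ck (Suc 0) (wn n)" for n
    by (rule Ck_SucI[OF Dw]) (simp, intro continuous_intros can cU c\<phi>)
  have off: "wn n x = 0" if "x \<notin> K" for n x
    unfolding wn_def using U(5)[OF that] \<kappa>(2)[of "\<phi> n x"] by (intro z) simp
  have pt: "AE x in M. u x \<ge> 0 \<and> (\<lambda>n. wn n x) \<longlonglongrightarrow> ?w x \<and> (\<lambda>n. an n x) \<longlonglongrightarrow> \<Phi>r (U x) (u x) \<and> (\<lambda>n. bn n x) \<longlonglongrightarrow> \<Phi>t (U x) (u x)"
    using u(2) \<phi>(2)
  proof eventually_elim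
    case (elim x)
    have k: "(\<lambda>n. \<kappa> (\<phi> n x)) \<longlonglongrightarrow> u x" "(\<lambda>n. \<kappa>' (\<phi> n x)) \<longlonglongrightarrow> 1"
      using continuous_on_tendsto_compose[OF \<kappa>(1) elim(2)] continuous_on_tendsto_compose[OF \<kappa>'(1) elim(2)] elim(1) \<kappa>(3) \<kappa>'(3)
      by auto
    have P: "(\<lambda>n. \<Psi> (U x) (\<kappa> (\<phi> n x))) \<longlonglongrightarrow> \<Psi> (U x) (u x)"
      if "continuous_on UNIV (\<lambda>z. \<Psi> (fst z) (snd z))" for \<Psi> :: "real \<Rightarrow> real \<Rightarrow> real"
      using continuous_on_tendsto_compose[OF that tendsto_Pair[OF tendsto_const k(1)], of "U x"] by simp
    show ?case unfolding wn_def an_def bn_def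
      using elim P[OF c\<Phi>] P[OF c(1)] tendsto_mult[OF P[OF c(2)] k(2)] by simp
  qed
  have mwn[measurable]: "wn n \<in> borel_measurable M" "an n \<in> borel_measurable M" "bn n \<in> borel_measurable M" for n
    by (intro continuous_measurable can)+
  have lim1: "(\<lambda>n. \<integral>x. (norm (wn n x - ?w x))\<^sup>2 \<partial>M) \<longlonglongrightarrow> 0"
  proof -
    have "(\<lambda>n. \<integral>x. (norm (wn n x - ?w x))\<^sup>2 \<partial>M) \<longlonglongrightarrow> (\<integral>x. 0 \<partial>M)"
    proof (rule integral_dominated_convergence[where w = "\<lambda>_. (2 * B0)\<^sup>2"])
      show "AE x in M. (\<lambda>n. (norm (wn n x - ?w x))\<^sup>2) \<longlonglongrightarrow> 0"
        using pt by eventually_elim (auto intro!: tendsto_eq_intros)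
      show "AE x in M. norm ((norm (wn n x - ?w x))\<^sup>2) \<le> (2 * B0)\<^sup>2" for n
        using bw(1)
      proof eventually_elim
        case (elim x)
        have "\<bar>wn n x - ?w x\<bar> \<le> 2 * B0" using bn(1)[of n x] elim by linarith
        then show ?case using power_mono[of "\<bar>wn n x - ?w x\<bar>" "2 * B0" 2] by simp
      qed
    qed auto
    then show ?thesis by simp
  qed
  \<comment> \<open>The error of the gradients is split in two: \<open>dn\<close> has converging
    bounded coefficients on the fixed fields \<open>grad U\<close> and \<open>g\<close>, so
    dominated convergence applies; the remainder is the bounded coefficient \<open>bn\<close> times
    the L^2-null sequence \<open>grad (\<phi> n) - g\<close>.\<close>
  define dn where "dn = (\<lambda>n x. (an n x - \<Phi>r (U x) (u x)) *\<^sub>R grad U x + (bn n x - \<Phi>t (U x) (u x)) *\<^sub>R g x)"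
  have mdn[measurable]: "dn n \<in> borel_measurable M" for n unfolding dn_def by measurable
  let ?W = "\<lambda>x. 2 * ((2 * B1)\<^sup>2 * (norm (grad U x))\<^sup>2) + 2 * ((2 * B2)\<^sup>2 * (norm (g x))\<^sup>2)"
  have iW: "integrable M ?W" using continuous_sq_int[OF cU(2)] su(2) by (auto simp: sq_int_def)
  have bdn: "AE x in M. (norm (dn n x))\<^sup>2 \<le> ?W x" for n
    using bw(2,3)
  proof eventually_elim
    case (elim x)
    have "\<bar>an n x - \<Phi>r (U x) (u x)\<bar> \<le> 2 * B1" "\<bar>bn n x - \<Phi>t (U x) (u x)\<bar> \<le> 2 * B2"
      using bn(2,3)[of n x] elim by linarith+
    then have "(an n x - \<Phi>r (U x) (u x))\<^sup>2 \<le> (2 * B1)\<^sup>2" "(bn n x - \<Phi>t (U x) (u x))\<^sup>2 \<le> (2 * B2)\<^sup>2"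
      using power_mono[of "\<bar>_\<bar>" _ 2] by fastforce+
    then have "2 * (norm ((an n x - \<Phi>r (U x) (u x)) *\<^sub>R grad U x))\<^sup>2 + 2 * (norm ((bn n x - \<Phi>t (U x) (u x)) *\<^sub>R g x))\<^sup>2 \<le> ?W x"
      unfolding norm_scaleR power_mult_distrib power2_abs by (intro add_mono mult_left_mono mult_right_mono) auto
    then show ?case unfolding dn_def by (rule order_trans[OF norm_add_sq_le])
  qed
  have limd: "(\<lambda>n. \<integral>x. (norm (dn n x))\<^sup>2 \<partial>M) \<longlonglongrightarrow> 0"
  proof -
    have "(\<lambda>n. \<integral>x. (norm (dn n x))\<^sup>2 \<partial>M) \<longlonglongrightarrow> (\<integral>x. 0 \<partial>M)"
    proof (rule integral_dominated_convergence[where w = ?W])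
      show "AE x in M. (\<lambda>n. (norm (dn n x))\<^sup>2) \<longlonglongrightarrow> 0"
        using pt unfolding dn_def
      proof eventually_elim
        case (elim x)
        then show ?case by (auto intro!: tendsto_eq_intros)
      qed
    qed (use iW bdn in auto)
    then show ?thesis by simp
  qed
  have lim2: "(\<lambda>n. \<integral>x. (norm (grad (wn n) x - ?\<psi> x))\<^sup>2 \<partial>M) \<longlonglongrightarrow> 0"
  proof (rule tendsto_sandwich[OF _ _ tendsto_const])
    let ?b = "\<lambda>n. 2 * (\<integral>x. (norm (dn n x))\<^sup>2 \<partial>M) + 2 * (B2\<^sup>2 * (\<integral>x. (norm (grad (\<phi> n) x - g x))\<^sup>2 \<partial>M))"
    show "?b \<longlonglongrightarrow> 0" using limd \<phi>(3) by (auto intro!: tendsto_eq_intros)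
    show "\<forall>\<^sub>F n in sequentially. (\<integral>x. (norm (grad (wn n) x - ?\<psi> x))\<^sup>2 \<partial>M) \<le> ?b n"
    proof (intro always_eventually allI)
      fix n
      have i1: "integrable M (\<lambda>x. (norm (dn n x))\<^sup>2)"
        by (rule Bochner_Integration.integrable_bound[OF iW]) (use bdn[of n] in \<open>auto elim!: eventually_mono\<close>)
      have i2: "integrable M (\<lambda>x. (norm (grad (\<phi> n) x - g x))\<^sup>2)"
        using sq_int_diff[OF continuous_sq_int[OF c\<phi>(2)] su(2)] by (simp add: sq_int_def)
      have i3: "integrable M (\<lambda>x. (norm (grad (wn n) x - ?\<psi> x))\<^sup>2)"
        using sq_int_diff[OF continuous_sq_int[OF Ck_Suc_continuous_grad[OF Cw]] s\<psi>] by (simp add: sq_int_def)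
      have "(\<integral>x. (norm (grad (wn n) x - ?\<psi> x))\<^sup>2 \<partial>M) \<le> (\<integral>x. 2 * (norm (dn n x))\<^sup>2 + 2 * (B2\<^sup>2 * (norm (grad (\<phi> n) x - g x))\<^sup>2) \<partial>M)"
      proof (rule integral_mono[OF i3])
        fix x
        have "grad (wn n) x - ?\<psi> x = dn n x + bn n x *\<^sub>R (grad (\<phi> n) x - g x)"
          by (simp add: gw dn_def algebra_simps)
        then have "(norm (grad (wn n) x - ?\<psi> x))\<^sup>2 \<le> 2 * (norm (dn n x))\<^sup>2 + 2 * ((bn n x)\<^sup>2 * (norm (grad (\<phi> n) x - g x))\<^sup>2)"
          using norm_add_sq_le[of "dn n x" "bn n x *\<^sub>R (grad (\<phi> n) x - g x)"] by (simp add: power_mult_distrib)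
        also have "\<dots> \<le> 2 * (norm (dn n x))\<^sup>2 + 2 * (B2\<^sup>2 * (norm (grad (\<phi> n) x - g x))\<^sup>2)"
          using power_mono[OF bn(3)[of n x], of 2] by (intro add_mono mult_left_mono mult_right_mono) auto
        finally show "(norm (grad (wn n) x - ?\<psi> x))\<^sup>2 \<le> 2 * (norm (dn n x))\<^sup>2 + 2 * (B2\<^sup>2 * (norm (grad (\<phi> n) x - g x))\<^sup>2)" .
      qed (use i1 i2 in auto)
      also have "\<dots> = ?b n" using i1 i2 by simp
      finally show "(\<integral>x. (norm (grad (wn n) x - ?\<psi> x))\<^sup>2 \<partial>M) \<le> ?b n" .
    qed
  qed (auto intro!: always_eventually integral_nonneg_AE)
  show "H10 \<Omega> ?w ?\<psi>"
    by (rule H10I[OF Cw U(3,4) off sw s\<psi> lim1 lim2])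
qed

end

section \<open>Comparison with subsolutions\<close>

lemma pos_part_square_deriv: "((\<lambda>t::real. (max 0 t)\<^sup>2) has_real_derivative 2 * max 0 t) (at t)"
proof -
  consider "t < 0" | "t > 0" | "t = 0" by linarith
  then show ?thesis
  proof cases
    case 1
    have "((\<lambda>_. 0) has_real_derivative 0) (at t)" by simp
    then show ?thesis using 1
      by (subst DERIV_cong_ev[OF refl _ refl, where g = "\<lambda>_. 0"])
         (use 1 eventually_nhds_in_open[of "{..<0}" t] in \<open>auto elim!: eventually_mono\<close>)
  next
    case 2
    have "((\<lambda>t. t\<^sup>2) has_real_derivative 2 * t) (at t)" by (auto intro!: derivative_eq_intros)
    then show ?thesis using 2
      by (subst DERIV_cong_ev[OF refl _ refl, where g = "\<lambda>t. t\<^sup>2"])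
         (use 2 eventually_nhds_in_open[of "{0<..}" t] in \<open>auto elim!: eventually_mono\<close>)
  next
    case 3
    have "isCont (\<lambda>s::real. max 0 s) 0" by (intro continuous_intros)
    then have "((\<lambda>s::real. max 0 s) \<longlongrightarrow> 0) (at 0)" by (simp add: isCont_def)
    then have "((\<lambda>s::real. (max 0 s)\<^sup>2 / s) \<longlongrightarrow> 0) (at 0)"
      by (rule Lim_transform_eventually) (auto simp: eventually_at_filter max_def power2_eq_square)
    then show ?thesis using 3 by (simp add: DERIV_def)
  qed
qed

text \<open>\<open>H10_compose\<close> asks for derivatives on the whole plane, so the primitives of
  \<open>k\<close> and \<open>G\<close> have to live on the whole line.\<close>

lemma antiderivative_exists:
  fixes f :: "real \<Rightarrow> real"
  assumes "continuous_on UNIV f"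
  obtains F where "\<And>x. (F has_real_derivative f x) (at x)"
proof -
  have "isCont f x" for x using assms continuous_on_eq_continuous_at by blast
  then obtain F where "\<forall>x :: real. (- \<infinity>::ereal) < x \<longrightarrow> x < (\<infinity>::ereal) \<longrightarrow> (F has_vector_derivative f x) (at x)"
    using einterval_antiderivative[of "- \<infinity>" "\<infinity>" f] by auto
  then show thesis by (intro that[of F]) (simp add: has_real_derivative_iff_has_vector_derivative)
qed

lemma integrable_mult_AE_bounded:
  fixes q c :: "'a \<Rightarrow> real"
  assumes "integrable N q" "c \<in> borel_measurable N" "AE x in N. \<bar>c x\<bar> \<le> B"
  shows "integrable N (\<lambda>x. q x * c x)"
proof (rule Bochner_Integration.integrable_bound[where f = "\<lambda>x. B * q x"])
  show "AE x in N. norm (q x * c x) \<le> norm (B * q x)"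
    using assms(3)
  proof eventually_elim
    case (elim x)
    have "\<bar>q x\<bar> * \<bar>c x\<bar> \<le> \<bar>q x\<bar> * \<bar>B\<bar>" using elim by (intro mult_left_mono) auto
    then show ?case by (simp add: abs_mult mult.commute)
  qed
qed (use assms in auto)

context bounded_domain
begin

text \<open>Two integrands with integral 0 are compared: \<open>P\<close> from the equation tested
  with G(u) b, and \<open>Q\<close> from integrating the Laplacian of v(U) by parts against b, where
  b = \<beta>(v(U) - v(u)). Pointwise Q - P is nonnegative, and positive where b > 0, so b = 0 a.e.
  Two derivatives of U are needed because the field grad(v(U)) must be C^1.\<close>

lemma solution_ge_subsolution:
  assumes sol: "is_solution \<Omega> \<sigma> h f lam u"
    and hc: "continuous_on {0..<\<sigma>} h" and h0: "\<And>s. 0 \<le> s \<Longrightarrow> s < \<sigma> \<Longrightarrow> h s \<ge> 0"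
    and f: "integrable M f" "AE x in M. f x \<ge> \<rho>" and lam: "lam \<ge> 0" "\<rho> \<ge> 0"
    and s1: "0 \<le> s1" "s1 < \<sigma>"
    and U: "Ck (Suc (Suc 0)) U" "\<And>x. U x \<le> s1" "compact K" "K \<subseteq> \<Omega>" "\<And>x. x \<notin> K \<Longrightarrow> U x \<le> - c0" "c0 > 0"
    and sub: "\<And>x. 0 < U x \<Longrightarrow>
       h (U x) * (norm (grad U x))\<^sup>2 - (\<Sum>i\<in>Basis. pdiff (pdiff U i) i x) < lam * \<rho>"
  shows "AE x in M. U x \<le> u x"
proof -
  from sol obtain g where g: "H10 \<Omega> u g" "AE x in M. 0 \<le> u x \<and> u x < \<sigma>"
    "integrable M (\<lambda>x. h (u x) * (norm (g x))\<^sup>2)"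
    and eq: "\<And>\<phi> \<psi>. H10 \<Omega> \<phi> \<psi> \<Longrightarrow> ess_bounded \<Omega> \<phi> \<Longrightarrow>
        (\<integral>x. g x \<bullet> \<psi> x \<partial>M) + (\<integral>x. h (u x) * (norm (g x))\<^sup>2 * \<phi> x \<partial>M) = lam * (\<integral>x. f x * \<phi> x \<partial>M)"
    unfolding is_solution_def LINT_eq AE_eq set_integrable_eq by blast
  have u0: "AE x in M. u x \<ge> 0" using g(2) by eventually_elim simp
  \<comment> \<open>\<open>h\<close> blows up at \<open>\<sigma>\<close>, but only its values on \<open>[0, s1]\<close> matter, because the test function vanishes where \<open>u \<ge> U\<close>.\<close>
  define k where "k = (\<lambda>s. h (max 0 (min s s1)))"
  have kc: "continuous_on UNIV k"
    unfolding k_def by (rule continuous_on_compose2[OF hc]) (use s1 in \<open>auto intro!: continuous_intros\<close>)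
  have k0: "k s \<ge> 0" for s unfolding k_def using s1 by (intro h0) auto
  have kh: "k s = h s" if "0 \<le> s" "s \<le> s1" for s using that by (simp add: k_def)
  obtain H where H: "\<And>x. (H has_real_derivative k x) (at x)" using antiderivative_exists[OF kc] by blast
  define G where "G = (\<lambda>s. exp (- H s))"
  have GD: "(G has_real_derivative - k s * G s) (at s)" for s
    unfolding G_def using H[of s] by (auto intro!: derivative_eq_intros)
  have Gc: "continuous_on UNIV G" by (intro continuous_at_imp_continuous_on ballI DERIV_isCont[OF GD])
  have Gpos: "G s > 0" for s by (simp add: G_def)
  have Gmono: "G r \<le> G t" if "t \<le> r" for r t
    using DERIV_nonneg_imp_nondecreasing[OF that, of H] H k0 by (force simp: G_def)
  obtain v where v: "\<And>x. (v has_real_derivative G x) (at x)" using antiderivative_exists[OF Gc] by blast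
  have vc: "continuous_on UNIV v" by (intro continuous_at_imp_continuous_on ballI DERIV_isCont[OF v])
  have vmono: "v t < v r" if "t < r" for r t
    using DERIV_pos_imp_increasing[OF that, of v] v Gpos by blast
  define \<beta> \<beta>' where "\<beta> = (\<lambda>t::real. (max 0 t)\<^sup>2)" and "\<beta>' = (\<lambda>t::real. 2 * max 0 t)"
  have \<beta>D: "(\<beta> has_real_derivative \<beta>' t) (at t)" for t unfolding \<beta>_def \<beta>'_def by (rule pos_part_square_deriv)
  have \<beta>c: "continuous_on UNIV \<beta>" "continuous_on UNIV \<beta>'" unfolding \<beta>_def \<beta>'_def by (intro continuous_intros)+
  have \<beta>0: "\<beta> (v r - v t) = 0" "\<beta>' (v r - v t) = 0" if "r \<le> t" for r t
    using vmono[of r t] that by (cases "r = t"; simp add: \<beta>_def \<beta>'_def)+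
  have D\<beta>: "((\<lambda>z. \<beta> (v (fst z) - v (snd z))) has_derivative
      (\<lambda>d. \<beta>' (v (fst z) - v (snd z)) * (G (fst z) * fst d - G (snd z) * snd d))) (at z)" for z :: "real \<times> real"
    by (intro has_derivative_compose[OF _ \<beta>D[unfolded has_field_derivative_def]] has_derivative_diff
        has_derivative_compose[OF _ v[unfolded has_field_derivative_def]] has_derivative_fst has_derivative_snd has_derivative_ident)
  have DG: "((\<lambda>z. G (snd z)) has_derivative (\<lambda>d. (- k (snd z) * G (snd z)) * snd d)) (at z)" for z :: "real \<times> real"
    by (intro has_derivative_compose[OF _ GD[unfolded has_field_derivative_def]] has_derivative_snd has_derivative_ident)
  have cs: "continuous_on UNIV (\<lambda>z::real \<times> real. F (fst z))" "continuous_on UNIV (\<lambda>z::real \<times> real. F (snd z))"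
    if "continuous_on UNIV F" for F :: "real \<Rightarrow> real"
    by (intro continuous_on_compose2[OF that] continuous_intros; simp)+
  have cv: "continuous_on UNIV (\<lambda>z::real \<times> real. v (fst z) - v (snd z))"
    by (intro continuous_on_diff cs vc)
  have c\<beta>: "continuous_on UNIV (\<lambda>z::real \<times> real. \<beta> (v (fst z) - v (snd z)))"
     "continuous_on UNIV (\<lambda>z::real \<times> real. \<beta>' (v (fst z) - v (snd z)))"
    by (intro continuous_on_compose2[OF \<beta>c(1) cv] continuous_on_compose2[OF \<beta>c(2) cv]; simp)+
  have U1: "Ck (Suc 0) U" by (rule Ck_SucD[OF U(1)])
  \<comment> \<open>\<open>\<psi>1\<close> and \<open>\<psi>2\<close> are the weak gradients of
    \<open>w1\<close> and \<open>b\<close> predicted by the chain rule with v' = G and G' = -k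
    G.\<close>
  define b where "b = (\<lambda>x. \<beta> (v (U x) - v (u x)))"
  define b' where "b' = (\<lambda>x. \<beta>' (v (U x) - v (u x)))"
  define w1 where "w1 = (\<lambda>x. G (u x) * b x)"
  define \<psi>1 where "\<psi>1 = (\<lambda>x. (G (u x) * b' x * G (U x)) *\<^sub>R grad U x +
      (- k (u x) * G (u x) * b x - G (u x) * b' x * G (u x)) *\<^sub>R g x)"
  define \<psi>2 where "\<psi>2 = (\<lambda>x. (b' x * G (U x)) *\<^sub>R grad U x + (- (b' x * G (u x))) *\<^sub>R g x)"
  have D1: "((\<lambda>z. G (snd z) * \<beta> (v (fst z) - v (snd z))) has_derivative
      (\<lambda>d. (G (snd z) * \<beta>' (v (fst z) - v (snd z)) * G (fst z)) * fst d +
        (- k (snd z) * G (snd z) * \<beta> (v (fst z) - v (snd z)) - G (snd z) * \<beta>' (v (fst z) - v (snd z)) * G (snd z)) * snd d)) (at z)"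
    for z :: "real \<times> real"
    by (rule has_derivative_eq_rhs[OF has_derivative_mult[OF DG D\<beta>]]) (simp add: fun_eq_iff algebra_simps)
  have D2: "((\<lambda>z. \<beta> (v (fst z) - v (snd z))) has_derivative
      (\<lambda>d. (\<beta>' (v (fst z) - v (snd z)) * G (fst z)) * fst d + (- (\<beta>' (v (fst z) - v (snd z)) * G (snd z))) * snd d)) (at z)"
    for z :: "real \<times> real"
    by (rule has_derivative_eq_rhs[OF D\<beta>]) (simp add: fun_eq_iff algebra_simps)
  have cc: "continuous_on UNIV (\<lambda>z::real \<times> real. G (snd z) * \<beta>' (v (fst z) - v (snd z)) * G (fst z))"
    "continuous_on UNIV (\<lambda>z::real \<times> real. - k (snd z) * G (snd z) * \<beta> (v (fst z) - v (snd z)) - G (snd z) * \<beta>' (v (fst z) - v (snd z)) * G (snd z))"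
    "continuous_on UNIV (\<lambda>z::real \<times> real. \<beta>' (v (fst z) - v (snd z)) * G (fst z))"
    "continuous_on UNIV (\<lambda>z::real \<times> real. - (\<beta>' (v (fst z) - v (snd z)) * G (snd z)))"
    by (intro continuous_on_diff continuous_on_minus continuous_on_mult c\<beta> cs(1)[OF Gc] cs(2)[OF Gc] cs(2)[OF kc])+
  note comp1 = H10_compose[where \<Phi> = "\<lambda>r t. G t * \<beta> (v r - v t)" and \<Phi>r = "\<lambda>r t. G t * \<beta>' (v r - v t) * G r"
      and \<Phi>t = "\<lambda>r t. - k t * G t * \<beta> (v r - v t) - G t * \<beta>' (v r - v t) * G t",
      OF g(1) u0 D1 cc(1) cc(2) _ _ _ U1 U(2-6)]
  note comp2 = H10_compose[where \<Phi> = "\<lambda>r t. \<beta> (v r - v t)" and \<Phi>r = "\<lambda>r t. \<beta>' (v r - v t) * G r"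
      and \<Phi>t = "\<lambda>r t. - (\<beta>' (v r - v t) * G t)",
      OF g(1) u0 D2 cc(3) cc(4) _ _ _ U1 U(2-6)]
  have H1: "H10 \<Omega> w1 \<psi>1" "ess_bounded \<Omega> w1"
    unfolding w1_def \<psi>1_def b_def b'_def by (rule comp1(1); simp add: \<beta>0) (rule comp1(2); simp add: \<beta>0)
  have H2: "H10 \<Omega> b \<psi>2"
    unfolding \<psi>2_def b_def b'_def by (rule comp2(1); simp add: \<beta>0)
  have sq: "sq_int M g" "sq_int M \<psi>1" "sq_int M \<psi>2" "sq_int M b"
    using g(1) H1 H2 by (auto simp: H10_iff)
  obtain B where B: "w1 \<in> borel_measurable M" "AE x in M. \<bar>w1 x\<bar> \<le> B"
    using H1(2) by (auto simp: ess_bounded_def set_borel_measurable_eq AE_eq)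
  define P where "P = (\<lambda>x. g x \<bullet> \<psi>1 x + h (u x) * (norm (g x))\<^sup>2 * w1 x - lam * (f x * w1 x))"
  have iP: "integrable M (\<lambda>x. g x \<bullet> \<psi>1 x)" "integrable M (\<lambda>x. h (u x) * (norm (g x))\<^sup>2 * w1 x)" "integrable M (\<lambda>x. f x * w1 x)"
    by (rule sq_int_inner[OF sq(1,2)], rule integrable_mult_AE_bounded[OF g(3) B], rule integrable_mult_AE_bounded[OF f(1) B])
  have P: "integrable M P" "integral\<^sup>L M P = 0"
    unfolding P_def using iP eq[OF H1] by auto
  define L where "L = (\<lambda>x. \<Sum>i\<in>Basis. pdiff (pdiff U i) i x)"
  \<comment> \<open>\<open>X i\<close> is the i-th partial derivative of v(U), and
    \<open>Y i\<close> is its derivative in direction i, so the sum of the \<open>Y i\<close> is the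
    Laplacian of v(U).\<close>
  define X where "X = (\<lambda>i x. G (U x) * pdiff U i x)"
  define Y where "Y = (\<lambda>i x. G (U x) * pdiff (pdiff U i) i x - k (U x) * G (U x) * (pdiff U i x)\<^sup>2)"
  have CU: "Ck (Suc 0) (pdiff U i)" if "i \<in> Basis" for i using U(1) that by simp
  have cU: "continuous_on UNIV U" by (rule Ck_continuous[OF U(1)])
  have GUD: "((\<lambda>x. G (U x)) has_derivative (\<lambda>d. (- k (U x) * G (U x)) * (grad U x \<bullet> d))) (at x)" for x
    by (rule has_derivative_compose[OF Ck_has_derivative[OF U1] GD[unfolded has_field_derivative_def]])
  have CGU: "Ck (Suc 0) (\<lambda>x. G (U x))"
    by (rule Ck_SucI[OF GUD])
       (simp add: grad_inner_Basis, intro continuous_intros continuous_on_compose2[OF kc cU] continuous_on_compose2[OF Gc cU] Ck_Suc_continuous_pdiff[OF U1]; simp)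
  have CX: "Ck (Suc 0) (X i)" if "i \<in> Basis" for i
    unfolding X_def by (rule Ck_mult[OF CGU CU[OF that]])
  have dX: "pdiff (X i) i x = Y i x" if i: "i \<in> Basis" for i x
    unfolding X_def pdiff_mult[OF CGU CU[OF i] i] pdiff_eq[OF GUD] grad_inner_Basis[OF i] Y_def
    by (simp add: power2_eq_square)
  have cY: "continuous_on UNIV (Y i)" if "i \<in> Basis" for i
    using Ck_Suc_continuous_pdiff[OF CX[OF that] that] dX[OF that] by (simp cong: continuous_on_cong)
  have iX: "integrable M (\<lambda>x. X i x * (\<psi>2 x \<bullet> i))" if "i \<in> Basis" for i
    using sq_int_inner[OF continuous_sq_int sq(3), of "\<lambda>x. X i x *\<^sub>R i"] Ck_continuous[OF CX[OF that]]
    by (simp add: inner_commute continuous_on_scaleR)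
  have iY: "integrable M (\<lambda>x. Y i x * b x)" if "i \<in> Basis" for i
    using sq_int_inner[OF continuous_sq_int[OF cY[OF that]] sq(4)] by simp
  define Q where "Q = (\<lambda>x. (\<Sum>i\<in>Basis. X i x * (\<psi>2 x \<bullet> i) + Y i x * b x))"
  have "integrable M Q" unfolding Q_def using iX iY by (intro Bochner_Integration.integrable_sum) auto
  moreover have "integral\<^sup>L M Q = 0"
  proof -
    have "integral\<^sup>L M Q = (\<Sum>i\<in>Basis. (\<integral>x. X i x * (\<psi>2 x \<bullet> i) \<partial>M) + (\<integral>x. Y i x * b x \<partial>M))"
      unfolding Q_def using iX iY by (subst Bochner_Integration.integral_sum) (auto intro!: sum.cong)
    also have "\<dots> = 0"
      using H10_integration_by_parts[OF H2 CX] dX by (intro sum.neutral) auto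
    finally show ?thesis .
  qed
  ultimately have Q: "integrable M Q" "integral\<^sup>L M Q = 0" by auto
  have Qeq: "Q x = G (U x) * (grad U x \<bullet> \<psi>2 x) + G (U x) * (L x - k (U x) * (norm (grad U x))\<^sup>2) * b x" for x
  proof -
    have "(\<Sum>i\<in>Basis. X i x * (\<psi>2 x \<bullet> i)) = G (U x) * (grad U x \<bullet> \<psi>2 x)"
      by (subst euclidean_inner[of "grad U x"]) (simp add: X_def sum_distrib_left grad_inner_Basis mult.assoc)
    moreover have "(norm (grad U x))\<^sup>2 = (\<Sum>i\<in>Basis. (pdiff U i x)\<^sup>2)"
      unfolding power2_norm_eq_inner by (subst euclidean_inner) (simp add: grad_inner_Basis power2_eq_square)
    then have "(\<Sum>i\<in>Basis. Y i x) = G (U x) * (L x - k (U x) * (norm (grad U x))\<^sup>2)"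
      unfolding Y_def L_def by (simp add: sum_subtractf sum_distrib_left algebra_simps)
    ultimately show ?thesis unfolding Q_def by (simp add: sum.distrib sum_distrib_right[symmetric])
  qed
  have pos: "AE x in M. 0 \<le> Q x - P x \<and> (b x > 0 \<longrightarrow> 0 < Q x - P x)"
    using g(2) f(2)
  proof eventually_elim
    case (elim x)
    define E where "E = k (U x) * (norm (grad U x))\<^sup>2 - L x"
    have b0: "b x \<ge> 0" "b' x \<ge> 0" by (auto simp: b_def b'_def \<beta>_def \<beta>'_def)
    have lt: "u x < U x" if "b x > 0" using that \<beta>0[of "U x" "u x"] by (force simp: b_def)
    \<comment> \<open>The truncated \<open>k\<close> agrees with \<open>h\<close> only up to
      \<open>s1\<close>; where b > 0 one has u < U \<le> s1, and elsewhere both sides are 0.\<close>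
    have hk: "h (u x) * b x = k (u x) * b x"
      using lt b0 kh[of "u x"] elim U(2)[of x] by (cases "b x > 0") auto
    \<comment> \<open>The gradient terms of both identities combine to a square.\<close>
    have "Q x - P x = b' x * (norm (G (U x) *\<^sub>R grad U x - G (u x) *\<^sub>R g x))\<^sup>2 + (G (u x) * (lam * f x) - G (U x) * E) * b x"
    proof -
      have "P x = G (u x) * b' x * G (U x) * (g x \<bullet> grad U x) - G (u x) * b' x * G (u x) * (g x \<bullet> g x)
          + (h (u x) * b x - k (u x) * b x) * G (u x) * (g x \<bullet> g x) - lam * (f x * w1 x)"
        unfolding P_def \<psi>1_def w1_def inner_add_right inner_scaleR_right power2_norm_eq_inner by (simp add: algebra_simps)
      then have Px: "P x = G (u x) * b' x * G (U x) * (g x \<bullet> grad U x) - G (u x) * b' x * G (u x) * (g x \<bullet> g x)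
          - lam * (f x * w1 x)" unfolding hk by simp
      show ?thesis
        unfolding Qeq Px \<psi>2_def w1_def E_def inner_add_right inner_scaleR_right inner_scaleR_left power2_norm_eq_inner inner_diff_left inner_diff_right
        by (simp add: algebra_simps inner_commute)
    qed
    moreover have "0 \<le> b' x * (norm (G (U x) *\<^sub>R grad U x - G (u x) *\<^sub>R g x))\<^sup>2" using b0 by simp
    moreover have "G (U x) * E < G (u x) * (lam * f x)" if "b x > 0"
    proof -
      have U0: "0 < U x" using lt[OF that] elim by simp
      have "E < lam * \<rho>" using sub[OF U0] kh[of "U x"] U0 U(2)[of x] by (simp add: E_def L_def)
      then have "G (U x) * E < G (U x) * (lam * \<rho>)" using Gpos by simp
      also have "\<dots> \<le> G (u x) * (lam * \<rho>)" using Gmono[of "u x" "U x"] lt[OF that] lam by (intro mult_right_mono) auto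
      also have "\<dots> \<le> G (u x) * (lam * f x)" using Gpos[of "u x"] elim lam by (intro mult_left_mono) auto
      finally show ?thesis .
    qed
    ultimately show ?case using b0 by (cases "b x > 0") (auto intro!: add_nonneg_pos add_nonneg_nonneg)
  qed
  have "AE x in M. Q x - P x = 0"
    by (subst integral_nonneg_eq_0_iff_AE[symmetric]) (use P Q pos in auto)
  with pos show ?thesis
  proof eventually_elim
    case (elim x)
    then have "\<not> b x > 0" by auto
    then have "\<not> v (u x) < v (U x)" by (auto simp: b_def \<beta>_def)
    then show ?case using vmono[of "u x" "U x"] by fastforce
  qed
qed

end

section \<open>Barriers\<close>

lemma Ck_power: "Ck k f \<Longrightarrow> Ck k (\<lambda>x. f x ^ n)"
  by (induction n) (auto intro: Ck_intros)

lemma sq_dist_has_derivative: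
  fixes z :: "'a::euclidean_space"
  shows "((\<lambda>x. (x - z) \<bullet> (x - z)) has_derivative (\<lambda>d. 2 * ((x - z) \<bullet> d))) (at x)"
  by (auto intro!: derivative_eq_intros simp: inner_commute)

lemma Ck_sq_dist: "Ck k (\<lambda>x::'a::euclidean_space. (x - z) \<bullet> (x - z))"
proof (cases k)
  case (Suc n)
  have "Ck n (\<lambda>x. 2 * ((x \<bullet> i) + - (z \<bullet> i)))" for i :: 'a by (intro Ck_intros)
  then show ?thesis unfolding Suc by (intro Ck_SucI[OF sq_dist_has_derivative]) (simp add: inner_diff_left)
qed (auto intro!: continuous_intros)

text \<open>The exponent is \<open>m = j + 2\<close>, so that no truncated subtraction occurs in the second derivatives.\<close>

definition barrier :: "real \<Rightarrow> real \<Rightarrow> nat \<Rightarrow> 'a::euclidean_space \<Rightarrow> 'a \<Rightarrow> real" where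
  "barrier s A j z x = s - A * ((x - z) \<bullet> (x - z)) ^ (j + 2)"

lemma Ck_barrier: "Ck k (barrier s A j z)"
proof -
  have "Ck k (\<lambda>x. s + (- A) * ((x - z) \<bullet> (x - z)) ^ (j + 2))"
    by (intro Ck_intros Ck_power Ck_sq_dist)
  then show ?thesis by (simp add: barrier_def[abs_def])
qed

lemma grad_barrier:
  "grad (barrier s A j z) x = (- (2 * real (j + 2) * A * ((x - z) \<bullet> (x - z)) ^ (j + 1))) *\<^sub>R (x - z)"
proof (rule grad_eqI)
  show "(barrier s A j z has_derivative
     (\<lambda>d. (- (2 * real (j + 2) * A * ((x - z) \<bullet> (x - z)) ^ (j + 1))) *\<^sub>R (x - z) \<bullet> d)) (at x)"
    unfolding barrier_def[abs_def]
    by (rule has_derivative_eq_rhs, rule has_derivative_diff[OF has_derivative_const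
          has_derivative_mult_right[OF has_derivative_power[OF sq_dist_has_derivative]]])
       (simp add: fun_eq_iff algebra_simps)
qed

lemma pdiff_barrier:
  assumes "i \<in> Basis"
  shows "pdiff (barrier s A j z) i = (\<lambda>x. - (2 * real (j + 2) * A) * (((x - z) \<bullet> (x - z)) ^ (j + 1) * ((x - z) \<bullet> i)))"
proof
  fix x
  show "pdiff (barrier s A j z) i x = - (2 * real (j + 2) * A) * (((x - z) \<bullet> (x - z)) ^ (j + 1) * ((x - z) \<bullet> i))"
    unfolding grad_inner_Basis[OF assms, symmetric] grad_barrier inner_scaleR_left by (simp add: mult.assoc)
qed

lemma pdiff_pdiff_barrier:
  assumes i: "i \<in> Basis"
  shows "pdiff (pdiff (barrier s A j z) i) i x = - (2 * real (j + 2) * A) *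
    (2 * real (j + 1) * ((x - z) \<bullet> (x - z)) ^ j * ((x - z) \<bullet> i)\<^sup>2 + ((x - z) \<bullet> (x - z)) ^ (j + 1))"
proof -
  have "((\<lambda>x. (x - z) \<bullet> i) has_derivative (\<lambda>d. d \<bullet> i)) (at x)" by (auto intro!: derivative_eq_intros)
  note D = has_derivative_mult_right[OF has_derivative_mult[OF has_derivative_power[OF sq_dist_has_derivative] this]]
  show ?thesis
    unfolding pdiff_barrier[OF i]
    by (rule trans[OF pdiff_eq[OF D]]) (use i in \<open>simp add: power2_eq_square ring_distribs ac_simps\<close>)
qed

text \<open>With m = j + 2 and N the dimension, this is the Laplacian 2m (2m - 2 + N) |x|^(2m - 2)
  of |x|^(2m), times -A.\<close>

lemma laplacian_barrier:
  fixes x z :: "'a::euclidean_space"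
  shows "(\<Sum>i\<in>Basis. pdiff (pdiff (barrier s A j z) i) i x) =
    - (2 * real (j + 2) * A * (2 * real (j + 1) + real DIM('a)) * ((x - z) \<bullet> (x - z)) ^ (j + 1))"
proof -
  have "(\<Sum>i\<in>Basis. ((x - z) \<bullet> i)\<^sup>2) = (x - z) \<bullet> (x - z)"
    by (subst euclidean_inner[of "x - z" "x - z"]) (simp add: power2_eq_square)
  then have "(\<Sum>i\<in>Basis. 2 * real (j + 1) * ((x - z) \<bullet> (x - z)) ^ j * ((x - z) \<bullet> i)\<^sup>2 + ((x - z) \<bullet> (x - z)) ^ (j + 1))
      = (2 * real (j + 1) + real DIM('a)) * ((x - z) \<bullet> (x - z)) ^ (j + 1)"
    unfolding sum.distrib sum_distrib_left[symmetric] by (simp add: ring_distribs ac_simps)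
  then show ?thesis
    by (simp only: pdiff_pdiff_barrier sum_distrib_left[symmetric] cong: sum.cong) (simp add: mult.assoc)
qed

text \<open>The exponent 2 j + 3 is 2m - 1: the square of A q^m, divided by q, up to the factor 4
  m^2.\<close>

lemma norm_grad_barrier:
  "(norm (grad (barrier s A j z) x))\<^sup>2 = 4 * (real (j + 2))\<^sup>2 * A\<^sup>2 * ((x - z) \<bullet> (x - z)) ^ (2 * j + 3)"
proof -
  have "q ^ (2 * j + 3) = (q ^ (j + 1))\<^sup>2 * q" for q :: real
    by (simp add: power_mult[symmetric] power_add power2_eq_square numeral_3_eq_3 mult.commute[of 2] power_mult)
  then show ?thesis
    unfolding grad_barrier norm_scaleR power_mult_distrib power2_abs power2_norm_eq_inner power2_minus
    by (simp del: power_Suc)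
qed

text \<open>Used with a = h(U) and d = \<sigma> - U. Put D = A q^m \<le> d: then a D^\<gamma> \<le>
  c, and splitting D^2 = D^\<gamma> D^(2 - \<gamma>) leaves c A^(2 - \<gamma>) q^(m (2 - \<gamma>) -
  1). The exponent is nonnegative, so q may be replaced by its upper bound \<open>T\<close>.\<close>

lemma singular_term_bound:
  fixes q :: real
  assumes q: "0 < q" "q \<le> T" and A: "A > 0" and \<gamma>: "1 \<le> \<gamma>" "\<gamma> < 2" "real m * (2 - \<gamma>) \<ge> 1"
    and d: "A * q ^ m \<le> d" and a: "a \<ge> 0" "a * d powr \<gamma> \<le> c"
  shows "a * (A\<^sup>2 * q ^ (2 * m)) / q \<le> c * A powr (2 - \<gamma>) * T powr (real m * (2 - \<gamma>) - 1)"
proof -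
  define D where "D = A * q ^ m"
  have D: "D > 0" using A q by (simp add: D_def)
  have "a * D powr \<gamma> \<le> a * d powr \<gamma>"
    using d D a \<gamma> by (intro mult_left_mono powr_mono2) (auto simp: D_def)
  then have 1: "a * D powr \<gamma> \<le> c" using a by simp
  have "A\<^sup>2 * q ^ (2 * m) = D\<^sup>2" by (simp add: D_def power_mult_distrib power_mult[symmetric] mult.commute)
  also have "\<dots> = D powr \<gamma> * D powr (2 - \<gamma>)" using D by (simp add: powr_add[symmetric])
  also have "D powr (2 - \<gamma>) = A powr (2 - \<gamma>) * q powr (real m * (2 - \<gamma>))"
    using A q by (simp add: D_def powr_mult powr_powr flip: powr_realpow)
  finally have e: "a * (A\<^sup>2 * q ^ (2 * m)) / q = (a * D powr \<gamma>) * (A powr (2 - \<gamma>) * q powr (real m * (2 - \<gamma>) - 1))"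
    using q by (simp add: powr_diff)
  have "\<dots> \<le> c * (A powr (2 - \<gamma>) * T powr (real m * (2 - \<gamma>) - 1))"
    using q \<gamma> a D by (intro mult_mono 1 mult_left_mono powr_mono2) (auto intro: order_trans[OF _ 1])
  then show ?thesis unfolding e by (simp add: mult.assoc)
qed

text \<open>The limit controls the product only close to \<sigma>. On the remaining interval [0, t]
  monotonicity bounds h by h(t), and the weight is at most \<sigma>^\<gamma>.\<close>

lemma singular_weight_bound:
  fixes h :: "real \<Rightarrow> real"
  assumes \<sigma>: "\<sigma> > 0" and h0: "\<forall>s\<in>{0..<\<sigma>}. h s \<ge> 0" and mono: "strict_mono_on {0..<\<sigma>} h"
    and \<gamma>: "\<gamma> \<ge> 1" and lim: "((\<lambda>s. (\<sigma> - s) powr \<gamma> * h s) \<longlongrightarrow> C) (at_left \<sigma>)"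
  obtains c where "c \<ge> 0" "\<And>s. 0 \<le> s \<Longrightarrow> s < \<sigma> \<Longrightarrow> h s * (\<sigma> - s) powr \<gamma> \<le> c"
proof -
  have "eventually (\<lambda>s. (\<sigma> - s) powr \<gamma> * h s < C + 1) (at_left \<sigma>)"
    using lim by (rule order_tendstoD) simp
  then obtain a where a: "a < \<sigma>" "\<And>s. a < s \<Longrightarrow> s < \<sigma> \<Longrightarrow> (\<sigma> - s) powr \<gamma> * h s < C + 1"
    unfolding eventually_at_left_field by auto
  define t where "t = (max a 0 + \<sigma>) / 2"
  have t: "0 \<le> t" "a < t" "t < \<sigma>" using a \<sigma> by (auto simp: t_def max_def)
  show thesis
  proof (rule that[of "max (C + 1) (h t * \<sigma> powr \<gamma>)"])
    show "0 \<le> max (C + 1) (h t * \<sigma> powr \<gamma>)" using h0 t by (auto simp: le_max_iff_disj)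
    fix s assume s: "0 \<le> s" "s < \<sigma>"
    show "h s * (\<sigma> - s) powr \<gamma> \<le> max (C + 1) (h t * \<sigma> powr \<gamma>)"
    proof (cases "s \<le> t")
      case True
      then have "h s \<le> h t" using mono s t unfolding strict_mono_on_def by (cases "s = t") (auto simp: less_le)
      then have "h s * (\<sigma> - s) powr \<gamma> \<le> h t * \<sigma> powr \<gamma>"
        using s t h0 \<gamma> by (intro mult_mono powr_mono2) auto
      then show ?thesis by simp
    next
      case False
      then show ?thesis using a(2)[of s] s t by (simp add: mult.commute)
    qed
  qed
qed

text \<open>|y| \<le> 1 + |y|^p, and constants are integrable on a set of finite measure.
  Integrability of f makes its product with a bounded test function integrable.\<close>

lemma Lp_integrable:
  fixes \<Omega> :: "'a::euclidean_space set"
  assumes "open \<Omega>" "bounded \<Omega>" "Lp p \<Omega> f" "p \<ge> 1"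
  shows "integrable (lebesgue_on \<Omega>) f"
proof -
  interpret bounded_domain \<Omega> using assms by unfold_locales
  have f: "f \<in> borel_measurable M" "integrable M (\<lambda>x. \<bar>f x\<bar> powr p)"
    using assms(3) by (auto simp: Lp_def set_borel_measurable_eq set_integrable_eq)
  have le: "\<bar>y\<bar> \<le> 1 + \<bar>y\<bar> powr p" for y :: real
  proof (cases "\<bar>y\<bar> \<le> 1")
    case False
    then show ?thesis using powr_mono[of 1 p "\<bar>y\<bar>"] assms(4) by simp
  qed (simp add: add_increasing2)
  have "integrable M (\<lambda>x. 1 + \<bar>f x\<bar> powr p)" using f(2) by simp
  then show ?thesis
    by (rule Bochner_Integration.integrable_bound[OF _ f(1)]) (simp add: le AE_I2)
qed

text \<open>The two summands in the bound on \<open>lam\<close> dominate h(U) |grad U|^2 and the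
  negative Laplacian of U on {U > 0}, which lies in the ball of radius R. Neither depends on
  \<open>s\<close> or \<open>z\<close>. The value of \<open>A\<close> makes A q^m equal to 2
  \<sigma> on the sphere, so that U \<le> s - 2 \<sigma> \<le> -\<sigma> outside the ball.\<close>

lemma barrier_le_solution:
  fixes \<Omega> :: "'a::euclidean_space set"
  assumes \<Omega>: "open \<Omega>" "bounded \<Omega>" and \<sigma>: "\<sigma> > 0"
    and h: "\<forall>s\<in>{0..<\<sigma>}. h s \<ge> 0" "continuous_on {0..<\<sigma>} h"
    and c: "c \<ge> 0" "\<And>s. 0 \<le> s \<Longrightarrow> s < \<sigma> \<Longrightarrow> h s * (\<sigma> - s) powr \<gamma> \<le> c"
    and f: "integrable (lebesgue_on \<Omega>) f" "AE x in lebesgue_on \<Omega>. f x \<ge> \<rho>" "\<rho> > 0"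
    and \<gamma>: "1 \<le> \<gamma>" "\<gamma> < 2" "real (j + 2) * (2 - \<gamma>) \<ge> 1"
    and R: "R > 0" "cball z R \<subseteq> \<Omega>" and A: "A = 2 * \<sigma> / R ^ (2 * (j + 2))"
    and lam: "4 * (real (j + 2))\<^sup>2 * (c * A powr (2 - \<gamma>) * (R\<^sup>2) powr (real (j + 2) * (2 - \<gamma>) - 1))
        + 2 * real (j + 2) * A * (2 * real (j + 1) + real DIM('a)) * (R\<^sup>2) ^ (j + 1) < lam * \<rho>"
    and s: "0 \<le> s" "s < \<sigma>" and sol: "is_solution \<Omega> \<sigma> h f lam u"
  shows "AE x in lebesgue_on \<Omega>. barrier s A j z x \<le> u x"
proof -
  interpret bounded_domain \<Omega> using \<Omega> by unfold_locales
  have A0: "A > 0" using A \<sigma> R by simp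
  have AR: "A * (R\<^sup>2) ^ (j + 2) = 2 * \<sigma>"
    using R unfolding A power_mult[symmetric] by simp
  define S where "S = 4 * (real (j + 2))\<^sup>2 * (c * A powr (2 - \<gamma>) * (R\<^sup>2) powr (real (j + 2) * (2 - \<gamma>) - 1))"
  define L where "L = 2 * real (j + 2) * A * (2 * real (j + 1) + real DIM('a)) * (R\<^sup>2) ^ (j + 1)"
  have SL: "0 \<le> S" "0 \<le> L" using c A0 by (auto simp: S_def L_def)
  have "lam * \<rho> > 0" using lam SL unfolding S_def[symmetric] L_def[symmetric] by linarith
  then have lam0: "lam \<ge> 0" using f(3) by (simp add: zero_less_mult_iff)
  show ?thesis
  proof (rule solution_ge_subsolution[OF sol h(2) _ f(1,2) lam0 _ s Ck_barrier _ compact_cball R(2) _ \<sigma>])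
    show "barrier s A j z x \<le> s" for x using A0 by (simp add: barrier_def)
    show "barrier s A j z x \<le> - \<sigma>" if "x \<notin> cball z R" for x
    proof -
      have "R\<^sup>2 \<le> (x - z) \<bullet> (x - z)"
        using that R power_mono[of R "norm (x - z)" 2] by (simp add: dist_norm norm_minus_commute power2_norm_eq_inner)
      then have "A * (R\<^sup>2) ^ (j + 2) \<le> A * ((x - z) \<bullet> (x - z)) ^ (j + 2)"
        using A0 by (intro mult_left_mono power_mono) auto
      then show ?thesis using s AR unfolding barrier_def by linarith
    qed
    fix x assume pos: "0 < barrier s A j z x"
    let ?U = "barrier s A j z"
    define q where "q = (x - z) \<bullet> (x - z)"
    have q0: "q \<ge> 0" by (simp add: q_def)
    have Uq: "?U x = s - A * q ^ (j + 2)" by (simp add: barrier_def q_def)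
    have qR: "q \<le> R\<^sup>2"
    proof (rule ccontr)
      assume "\<not> q \<le> R\<^sup>2"
      then have "A * (R\<^sup>2) ^ (j + 2) \<le> A * q ^ (j + 2)" using A0 by (intro mult_left_mono power_mono) auto
      then show False using pos Uq AR s by linarith
    qed
    have "h (?U x) * (norm (grad ?U x))\<^sup>2 \<le> S"
    \<comment> \<open>The estimate divides by q; at the centre the gradient is 0 and the term
      vanishes.\<close>
    proof (cases "q = 0")
      case True
      then show ?thesis using SL by (simp add: norm_grad_barrier q_def[symmetric] zero_power)
    next
      case False
      then have q: "q > 0" using q0 by simp
      have "0 \<le> A * q ^ (j + 2)" using A0 q0 by simp
      then have Us: "0 \<le> ?U x" "?U x < \<sigma>" using pos Uq s by linarith+
      have "h (?U x) * (A\<^sup>2 * q ^ (2 * (j + 2))) / q \<le> c * A powr (2 - \<gamma>) * (R\<^sup>2) powr (real (j + 2) * (2 - \<gamma>) - 1)"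
      proof (rule singular_term_bound[OF q qR A0 \<gamma> _ _ c(2)[OF Us]])
        show "A * q ^ (j + 2) \<le> \<sigma> - ?U x" using Uq s by simp
      qed (use h(1) Us in auto)
      then have "4 * (real (j + 2))\<^sup>2 * (h (?U x) * (A\<^sup>2 * q ^ (2 * (j + 2))) / q) \<le> S"
        unfolding S_def by (intro mult_left_mono) auto
      moreover have "q ^ (2 * (j + 2)) = q ^ (2 * j + 3) * q" by (simp flip: power_Suc2 add: numeral_3_eq_3)
      then have "4 * (real (j + 2))\<^sup>2 * (h (?U x) * (A\<^sup>2 * q ^ (2 * (j + 2))) / q) = h (?U x) * (norm (grad ?U x))\<^sup>2"
        unfolding norm_grad_barrier q_def[symmetric] using q by simp
      ultimately show ?thesis by simp
    qed
    moreover have "- (\<Sum>i\<in>Basis. pdiff (pdiff ?U i) i x) \<le> L"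
      unfolding laplacian_barrier L_def minus_minus q_def[symmetric]
      using qR q0 A0 by (intro mult_left_mono power_mono) auto
    ultimately show "h (?U x) * (norm (grad ?U x))\<^sup>2 - (\<Sum>i\<in>Basis. pdiff (pdiff ?U i) i x) < lam * \<rho>"
      using lam unfolding S_def[symmetric] L_def[symmetric] by linarith
  qed (use h f in auto)
qed

theorem theorem1p10:
  fixes \<Omega> :: "'a::euclidean_space set" and \<sigma> :: real and h :: "real \<Rightarrow> real"
    and f :: "'a \<Rightarrow> real" and p :: real
  assumes "open \<Omega>" and "bounded \<Omega>" and "\<Omega> \<noteq> {}"
    and "\<sigma> > 0"
    and "\<forall>s\<in>{0..<\<sigma>}. h s \<ge> 0"
    and "continuous_on {0..<\<sigma>} h"
    and "strict_mono_on {0..<\<sigma>} h"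
    and "filterlim h at_top (at_left \<sigma>)"
    and "p > real DIM('a) / 2" and "p \<ge> 1"
    and "Lp p \<Omega> f"
    and "\<gamma> \<ge> 1" and "\<gamma> < 2" and "C > 0"
    and "((\<lambda>s. (\<sigma> - s) powr \<gamma> * h s) \<longlongrightarrow> C) (at_left \<sigma>)"
    and "\<rho> > 0" and "AE x in lebesgue. x \<in> \<Omega> \<longrightarrow> f x \<ge> \<rho>"
  shows "(\<exists>\<Lambda>0. \<forall>lam\<ge>\<Lambda>0. \<not> (\<exists>u. is_solution \<Omega> \<sigma> h f lam u)) \<and> Lambda_f \<Omega> \<sigma> h f < \<infinity>"
proof -
  interpret bounded_domain \<Omega> using assms(1,2) by unfold_locales
  obtain c where c: "c \<ge> 0" "\<And>s. 0 \<le> s \<Longrightarrow> s < \<sigma> \<Longrightarrow> h s * (\<sigma> - s) powr \<gamma> \<le> c"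
    using singular_weight_bound[OF assms(4,5,7,12,15)] by blast
  have f: "integrable M f" "AE x in M. f x \<ge> \<rho>"
    using Lp_integrable[OF assms(1,2,11,10)] assms(17) by (auto simp: AE_eq)
  \<comment> \<open>\<open>j\<close> only has to be large: the exponent m = j + 2 then satisfies m
    (2 - \<gamma>) \<ge> 1.\<close>
  obtain j where "1 / (2 - \<gamma>) \<le> real j" using real_arch_simple by blast
  then have j: "real (j + 2) * (2 - \<gamma>) \<ge> 1"
    using assms(13) by (simp add: divide_le_eq algebra_simps)
  obtain z0 where "z0 \<in> \<Omega>" using assms(3) by auto
  then obtain R0 where R0: "R0 > 0" "cball z0 R0 \<subseteq> \<Omega>" using assms(1) open_contains_cball by blast
  \<comment> \<open>Half the radius: balls of radius \<open>R\<close> about all centres in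
    \<open>ball z0 R\<close> still lie in \<Omega>, so one \<open>A\<close> and one threshold serve
    every centre.\<close>
  define R where "R = R0 / 2"
  have R: "R > 0" using R0 by (simp add: R_def)
  have cb: "cball z R \<subseteq> \<Omega>" if "z \<in> ball z0 R" for z
  proof
    fix y assume "y \<in> cball z R"
    then have "dist z0 y \<le> R0" using that dist_triangle[of z0 y z] by (simp add: R_def)
    then show "y \<in> \<Omega>" using R0 by auto
  qed
  define A where "A = 2 * \<sigma> / R ^ (2 * (j + 2))"
  have A0: "A > 0" using R assms(4) by (simp add: A_def)
  define S where "S = 4 * (real (j + 2))\<^sup>2 * (c * A powr (2 - \<gamma>) * (R\<^sup>2) powr (real (j + 2) * (2 - \<gamma>) - 1))
        + 2 * real (j + 2) * A * (2 * real (j + 1) + real DIM('a)) * (R\<^sup>2) ^ (j + 1)"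
  define \<Lambda> where "\<Lambda> = S / \<rho> + 1"
  have no: "\<not> is_solution \<Omega> \<sigma> h f lam u" if "lam \<ge> \<Lambda>" for lam u
  proof
    assume sol: "is_solution \<Omega> \<sigma> h f lam u"
    have lam: "S < lam * \<rho>"
    proof -
      have "S < \<Lambda> * \<rho>" using assms(16) by (simp add: \<Lambda>_def algebra_simps)
      also have "\<dots> \<le> lam * \<rho>" using that assms(16) by simp
      finally show ?thesis .
    qed
    \<comment> \<open>Each centre and each level has its own exceptional null set. Restricting to
      countably many of both allows a common one.\<close>
    obtain D :: "'a set" where D: "countable D" "\<And>X. open X \<Longrightarrow> X \<noteq> {} \<Longrightarrow> \<exists>d\<in>D. d \<in> X"
      using countable_dense_exists by metis
    define s where "s = (\<lambda>n. \<sigma> - \<sigma> / real (Suc n))"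
    have s: "0 \<le> s n" "s n < \<sigma>" for n using assms(4) by (auto simp: s_def divide_le_eq)
    have slim: "s \<longlonglongrightarrow> \<sigma>"
    proof -
      have "(\<lambda>n. \<sigma> - \<sigma> * inverse (real (Suc n))) \<longlonglongrightarrow> \<sigma> - \<sigma> * 0"
        by (intro tendsto_intros LIMSEQ_inverse_real_of_nat)
      then show ?thesis by (simp add: s_def divide_inverse)
    qed
    have "AE x in M. barrier (s n) A j z x \<le> u x" if "z \<in> D \<inter> ball z0 R" for z n
      using barrier_le_solution[OF assms(1,2,4,5,6) c f assms(16,12,13) j R cb A_def lam[unfolded S_def] s sol] that by blast
    then have all: "AE x in M. \<forall>z\<in>D \<inter> ball z0 R. \<forall>n. barrier (s n) A j z x \<le> u x"
      by (subst AE_ball_countable) (use D in \<open>auto simp: AE_all_countable intro: countable_Int1\<close>)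
    \<comment> \<open>At a fixed x, choose centres \<open>d n\<close> in \<open>D\<close> that tend
      to x, together with the levels \<open>s n\<close>: the barrier values at x tend to \<sigma>
      because x - d n tends to 0.\<close>
    have ge: "\<sigma> \<le> u x" if x: "x \<in> ball z0 R" and le: "\<forall>z\<in>D \<inter> ball z0 R. \<forall>n. barrier (s n) A j z x \<le> u x" for x
    proof -
      have "\<exists>d\<in>D. d \<in> ball z0 R \<inter> ball x (1 / real (Suc n))" for n
        by (rule D(2)) (use x in \<open>auto intro!: exI[of _ x]\<close>)
      then obtain d where d: "\<And>n. d n \<in> D \<inter> ball z0 R" "\<And>n. dist x (d n) < 1 / real (Suc n)"
        by (metis IntI IntD1 IntD2 mem_ball)
      have "(\<lambda>n. dist (d n) x) \<longlonglongrightarrow> 0"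
      proof (rule Lim_null_comparison[OF always_eventually])
        show "\<forall>n. norm (dist (d n) x) \<le> inverse (real (Suc n))"
          using d(2) by (auto simp: dist_commute inverse_eq_divide intro: less_imp_le)
      qed (rule LIMSEQ_inverse_real_of_nat)
      then have "d \<longlonglongrightarrow> x" by (rule tendsto_dist_iff[THEN iffD2])
      then have "(\<lambda>n. barrier (s n) A j (d n) x) \<longlonglongrightarrow> \<sigma> - A * ((x - x) \<bullet> (x - x)) ^ (j + 2)"
        unfolding barrier_def by (intro tendsto_intros slim)
      then have "(\<lambda>n. barrier (s n) A j (d n) x) \<longlonglongrightarrow> \<sigma>" by simp
      then show ?thesis by (rule LIMSEQ_le_const2) (use le d in auto)
    qed
    have "AE x in M. u x < \<sigma>"
      using sol unfolding is_solution_def AE_eq by auto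
    with all have "AE x in M. x \<notin> ball z0 R"
      by eventually_elim (use ge in force)
    \<comment> \<open>The ball lies in \<Omega>, so the statement on \<Omega> extends to the whole
      space and says that the ball is a null set.\<close>
    then have "AE x in lebesgue. x \<notin> ball z0 R"
      unfolding AE_eq[symmetric]
      by (rule eventually_mono) (use R0 in \<open>auto simp: R_def subset_iff\<close>)
    then have "negligible (ball z0 R)"
      unfolding negligible_iff_null_sets by (subst AE_iff_null_sets) auto
    then show False using open_not_negligible[of "ball z0 R"] R by auto
  qed
  have "lam \<le> max 0 \<Lambda>" if "lam \<in> Lambda_set \<Omega> \<sigma> h f" for lam
  proof -
    obtain u where "is_solution \<Omega> \<sigma> h f lam u" using \<open>lam \<in> Lambda_set \<Omega> \<sigma> h f\<close> unfolding Lambda_set_def by blast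
    then have "\<not> \<Lambda> \<le> lam" using no by blast
    then show ?thesis by simp
  qed
  \<comment> \<open>The maximum with 0 also covers the empty set, for which \<open>Lambda_f\<close>
    is 0 by convention.\<close>
  then have "Sup (ereal ` Lambda_set \<Omega> \<sigma> h f) \<le> ereal (max 0 \<Lambda>)"
    by (intro SUP_least) (simp only: ereal_less_eq)
  then have "Lambda_f \<Omega> \<sigma> h f \<le> ereal (max 0 \<Lambda>)"
    unfolding Lambda_f_def by (cases "Lambda_set \<Omega> \<sigma> h f = {}") (simp_all add: zero_ereal_def le_max_iff_disj)
  then have "Lambda_f \<Omega> \<sigma> h f < \<infinity>" by (rule le_less_trans) (simp add: max_def)
  then show ?thesis using no by blast
qed

end
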